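(* For all integers $n\ge 0$ and $\alpha\ge 0$, \begin{align*} v_0(2^{2\alpha+1}(2n+1)) &\equiv 0 \pmod{2^{3\alpha}},\\ v_0(2^{2\alpha+2}(4n+3)) &\equiv 0 \pmod{2^{3\alpha+4}},\\ v_0(2^{2\alpha+2}(8n+7)) &\equiv 0 \pmod{2^{3\alpha+6}},\\ v_0(2^{2\alpha+2}(8n+5)) &\equiv 0 \pmod{2^{3\alpha+6}}. \end{align*}
   Context: The integer sequence $v_0(n)$, $n\ge 0$, is defined by the generating function (formal power series in $q$) $$\sum_{n=0}^\infty v_0(n)q^n=\sum_{n=0}^\infty \frac{q^{n^2}(-q;q^2)_n}{(q;q^2)_n},$$ where $(a;q)_0=1$ and $(a;q)_n=\prod_{i=1}^n(1-aq^{i-1})$ for $n\ge1$, so that $(-q;q^2)_n=\prod_{i=1}^n(1+q^{2i-1})$ and $(q;q^2)_n=\prod_{i=1}^n(1-q^{2i-1})$. *)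

theory Defs
  imports "HOL-Computational_Algebra.Formal_Power_Series" "HOL-Number_Theory.Cong"
begin

definition qpoch :: "'a::comm_ring_1 \<Rightarrow> 'a \<Rightarrow> nat \<Rightarrow> 'a" where
  "qpoch a q n = (\<Prod>i=1..n. 1 - a * q ^ (i - 1))"

(* The type int has no inverse operation, so division of int fps is unavailable.
   fps_right_inverse f 1 is the multiplicative inverse of a power series f with
   constant term 1; see v0_summand_mult below. *)
definition v0_summand :: "nat \<Rightarrow> int fps" where
  "v0_summand n = fps_X ^ (n\<^sup>2) * qpoch (- fps_X) (fps_X\<^sup>2) n
                    * fps_right_inverse (qpoch fps_X (fps_X\<^sup>2) n) 1"

(* The infinite sum is taken in the X-adic metric on formal power series;
   it converges by v0_summand_sums below. *)
definition v0 :: "nat \<Rightarrow> int" where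
  "v0 n = fps_nth (\<Sum>k. v0_summand k) n"

lemma qpoch_fps_X_nth_0: "fps_nth (qpoch fps_X (fps_X\<^sup>2) n :: int fps) 0 = 1"
proof (induction n)
  case (Suc n)
  then show ?case by (simp add: qpoch_def)
qed (simp add: qpoch_def)

lemma v0_summand_mult:
  "v0_summand n * qpoch fps_X (fps_X\<^sup>2) n = fps_X ^ (n\<^sup>2) * qpoch (- fps_X) (fps_X\<^sup>2) n"
proof -
  let ?f = "qpoch fps_X (fps_X\<^sup>2) n :: int fps"
  have "fps_right_inverse ?f 1 * ?f = 1"
    using fps_right_inverse[of ?f 1] by (simp add: qpoch_fps_X_nth_0 mult.commute)
  then show ?thesis
    unfolding v0_summand_def by (simp only: mult.assoc mult_1_right)
qed

lemma v0_summand_nth_eq_0: "N < n\<^sup>2 \<Longrightarrow> fps_nth (v0_summand n) N = 0"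
  by (simp add: v0_summand_def mult.assoc fps_X_power_mult_nth)

lemma v0_summand_sums: "v0_summand sums Abs_fps (\<lambda>N. \<Sum>k\<le>N. fps_nth (v0_summand k) N)"
  unfolding sums_def tendsto_fps_iff
proof
  fix N
  have "fps_nth (\<Sum>k<m. v0_summand k) N = (\<Sum>k\<le>N. fps_nth (v0_summand k) N)" if "m > N" for m
  proof -
    have "k\<^sup>2 > N" if "k > N" for k :: nat
      using that by (metis le_square less_le_trans power2_eq_square)
    then have "(\<Sum>k<m. fps_nth (v0_summand k) N) = (\<Sum>k\<le>N. fps_nth (v0_summand k) N)"
      using that by (intro sum.mono_neutral_right) (auto simp: v0_summand_nth_eq_0)
    then show ?thesis by (simp add: fps_sum_nth)
  qed
  then have "\<forall>\<^sub>F m in sequentially. fps_nth (\<Sum>k<m. v0_summand k) N =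
      (\<Sum>k\<le>N. fps_nth (v0_summand k) N)"
    by (auto intro: eventually_mono[OF eventually_gt_at_top[of N]])
  then show "\<forall>\<^sub>F m in sequentially. fps_nth (\<Sum>k<m. v0_summand k) N =
      fps_nth (Abs_fps (\<lambda>N. \<Sum>k\<le>N. fps_nth (v0_summand k) N)) N"
    by simp
qed

lemma v0_eq_sum: "v0 N = (\<Sum>k\<le>N. fps_nth (v0_summand k) N)"
  using sums_unique[OF v0_summand_sums] by (metis fps_nth_Abs_fps v0_def)

end

theory Submission
  imports Defs Complex_Main
begin

text \<open>
  Write \<open>\<phi>(q)\<close> for the theta series \<open>\<Sum> q^(n^2)\<close> over all integers and
  \<open>G(w) = \<Sum> q^(n^2) \<Prod> (w + q^(2i-1)) / (1 - w q^(2i-1))\<close>, so that \<open>G(1)\<close> generates \<open>v0\<close> and \<open>G(-1)\<close>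
  is \<open>G(1)\<close> at \<open>-q\<close>. A telescoping argument gives
  \<open>(1 + q^2 w^2) S(q^2 w) = (1 - q^2 w^2) S(w)\<close> for \<open>S(w) = G(w) + G(-w) - 1\<close>. Hence
  \<open>S(w) S(i w)\<close> is invariant under \<open>w \<mapsto> q^2 w\<close> and equals \<open>S(0)^2\<close>. At \<open>w = 1\<close> the series \<open>S(i)\<close> and
  \<open>S(0)\<close> collapse to \<open>\<phi>(-q^4)\<close> and \<open>\<phi>(q^2)\<close>, which determines the even part of \<open>v0\<close>; in particular
  \<open>B(q) = 2 \<Sum> v0(4n) q^n - 1 = \<phi>(q)^2 / \<phi>(-q)\<close>.

  Let \<open>U\<close> be the operator \<open>\<Sum> c(n) q^n \<mapsto> \<Sum> c(4n) q^n\<close> and \<open>s = \<phi>(q)^4 / \<phi>(-q)^4\<close>.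
  Put \<open>a = \<phi>(q^4)\<close> and \<open>\<beta> = \<phi>(q)/a - 1\<close>, whose exponents are all 1 modulo 4. Then
  \<open>\<phi>(-q) = a (1 - \<beta>)\<close>, \<open>(1 - \<beta>^4) s(q^4) = 1\<close> and
  \<open>s - 1 = 8 \<beta> (1 + \<beta>)^4 (1 + \<beta>^2)^5 s(q^4)^4\<close>, so \<open>U\<close> maps \<open>\<phi> (s - 1) R\<close> into \<open>8 \<phi> (s - 1) R\<close> for
  \<open>R = Z[s, 1/s]\<close>, while \<open>U B = \<phi> + 4 \<phi> (s - 1)\<close>. The term \<open>\<phi>\<close> only meets squares, and the remaining
  factors of 2 are read off \<open>\<phi> (s - 1) / 16\<close> modulo 16, expanded in \<open>\<beta>/2\<close>.
\<close>

unbundle fps_syntax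

section \<open>A telescoping q-series\<close>

definition gm_inv :: "nat \<Rightarrow> complex fps \<Rightarrow> complex fps" where
  "gm_inv n w = inverse (1 - w * fps_X ^ (2 * n + 1))"

lemma gm_inv_mult: "gm_inv n w * (1 - w * fps_X ^ (2 * n + 1)) = 1"
  unfolding gm_inv_def by (rule inverse_mult_eq_1) (simp add: mult.assoc)

text \<open>The parameter \<open>w\<close> is itself a power series in q, so the shift from w to q^2
  w is plain multiplication; complex coefficients make w = i available.\<close>

primrec gm_term :: "nat \<Rightarrow> complex fps \<Rightarrow> complex fps" where
  "gm_term 0 w = 1"
| "gm_term (Suc n) w = gm_term n w * (fps_X ^ (2 * n + 1) * (w + fps_X ^ (2 * n + 1)) * gm_inv n w)"

text \<open>Whatever \<open>w\<close> is, only finitely many terms then reach a given coefficient,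
  which is what makes the infinite sum meaningful.\<close>

lemma gm_term_dvd: "fps_X ^ n\<^sup>2 dvd gm_term n w"
proof (induction n)
  case (Suc n)
  have "fps_X ^ (Suc n)\<^sup>2 = (fps_X ^ n\<^sup>2 * fps_X ^ (2 * n + 1) :: complex fps)"
    unfolding power_add[symmetric] by (simp add: power2_eq_square)
  moreover have "\<dots> dvd gm_term (Suc n) w"
    unfolding gm_term.simps using Suc by (intro mult_dvd_mono) (simp_all add: mult.assoc)
  ultimately show ?case by simp
qed simp

lemma fps_X_power_dvd_nth_eq_0:
  fixes f :: "'a::comm_ring_1 fps"
  assumes "fps_X ^ m dvd f" "n < m"
  shows "f $ n = 0"
  using assms by (auto simp: fps_X_power_mult_nth)

lemma gm_inv_shift: "gm_inv n (w * fps_X\<^sup>2) = gm_inv (Suc n) w"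
  by (simp add: gm_inv_def mult.assoc power_add power2_eq_square)

lemma power_linear_exponents:
  fixes a :: "'a::comm_monoid_mult"
  shows "a ^ (2 * n) = (a ^ n)\<^sup>2" "a ^ (4 * n) = (a ^ n) ^ 4"
    "a ^ (2 * n + k) = (a ^ n)\<^sup>2 * a ^ k" "a ^ (4 * n + k) = (a ^ n) ^ 4 * a ^ k"
proof -
  show 1: "a ^ (2 * n) = (a ^ n)\<^sup>2" and 2: "a ^ (4 * n) = (a ^ n) ^ 4" for n
    by (metis mult.commute power_mult)+
  show "a ^ (2 * n + k) = (a ^ n)\<^sup>2 * a ^ k" "a ^ (4 * n + k) = (a ^ n) ^ 4 * a ^ k"
    by (simp_all only: power_add 1 2)
qed

text \<open>For i > 0 the numerator factor satisfies w q^2 + q^(2i+1) = q^2 (w + q^(2i-1)), so the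
  shifted numerators are the old ones, one index lower. The factor i = 0 is q (1 + w q); the
  denominators lose 1 - w q and gain two new factors. Together 1 + w q and 1 - w q give 1 - (w
  q)^2.\<close>

lemma gm_term_shift:
  "gm_term (Suc n) (w * fps_X\<^sup>2) =
     gm_term n w * fps_X ^ (4 * n + 2) * (1 - (w * fps_X)\<^sup>2) * gm_inv n w * gm_inv (Suc n) w"
proof (induction n)
  case 0
  define I where "I = gm_inv 0 w"
  define J where "J = gm_inv (Suc 0) w"
  have "I * (1 - w * fps_X) = 1"
    using gm_inv_mult[of 0 w] by (simp add: I_def)
  moreover have "gm_term (Suc 0) (w * fps_X\<^sup>2) = fps_X * (w * fps_X\<^sup>2 + fps_X) * J"
    by (simp add: gm_inv_shift J_def)
  moreover have "gm_term 0 w * fps_X ^ (4 * 0 + 2) * (1 - (w * fps_X)\<^sup>2) * gm_inv 0 w * gm_inv (Suc 0) w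
     = fps_X\<^sup>2 * (1 - (w * fps_X)\<^sup>2) * I * J"
    by (simp only: I_def J_def gm_term.simps mult_0_right add_0 mult_1_left)
  moreover have "q * (w * q\<^sup>2 + q) * J = q\<^sup>2 * (1 - (w * q)\<^sup>2) * I * J"
    if "I * (1 - w * q) = 1" for q
    using that by algebra
  ultimately show ?case by (simp only:)
next
  case (Suc n)
  define A where "A = (fps_X ^ n :: complex fps)"
  define I where "I = gm_inv n w"
  define J where "J = gm_inv (Suc n) w"
  define K where "K = gm_inv (Suc (Suc n)) w"
  define q where "q = (fps_X :: complex fps)"
  define T where "T = gm_term n w"
  have X: "fps_X ^ (2 * n + 1) = A\<^sup>2 * q" "fps_X ^ (2 * Suc n + 1) = A\<^sup>2 * q ^ 3"
     "fps_X ^ (4 * n + 2) = A ^ 4 * q\<^sup>2" "fps_X ^ (4 * Suc n + 2) = A ^ 4 * q ^ 6"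
    unfolding A_def q_def power_linear_exponents power_Suc
    by (rule refl | algebra)+
  have "gm_term (Suc (Suc n)) (w * fps_X\<^sup>2) =
     T * (A ^ 4 * q\<^sup>2) * (1 - (w * q)\<^sup>2) * I * J * ((A\<^sup>2 * q ^ 3) * (w * q\<^sup>2 + (A\<^sup>2 * q ^ 3)) * K)"
    by (subst gm_term.simps(2), subst Suc.IH)
       (simp only: gm_inv_shift X I_def J_def K_def q_def T_def)
  moreover have "gm_term (Suc n) w * fps_X ^ (4 * Suc n + 2) * (1 - (w * fps_X)\<^sup>2) * gm_inv (Suc n) w * gm_inv (Suc (Suc n)) w
    = T * (A\<^sup>2 * q * (w + A\<^sup>2 * q) * I) * (A ^ 4 * q ^ 6) * (1 - (w * q)\<^sup>2) * J * K"
    by (subst gm_term.simps(2)) (simp only: X I_def J_def K_def q_def T_def)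
  moreover have "T * (A ^ 4 * q\<^sup>2) * (1 - (w * q)\<^sup>2) * I * J * ((A\<^sup>2 * q ^ 3) * (w * q\<^sup>2 + (A\<^sup>2 * q ^ 3)) * K)
    = T * (A\<^sup>2 * q * (w + A\<^sup>2 * q) * I) * (A ^ 4 * q ^ 6) * (1 - (w * q)\<^sup>2) * J * K"
    by algebra
  ultimately show ?case by (simp only:)
qed

lemma diff_add_diff_cancel_left: "(x - c) + (y - x) = y - (c::'a::ab_group_add)"
  by simp

text \<open>A telescoping certificate: the increments of the summand with \<open>gm_term N w\<close>
  on the right match the new terms on the left. That summand has order at least N^2, so only - p (1
  - p) survives in the limit.\<close>

lemma gm_partial_sum_shift:
  fixes w :: "complex fps"
  defines "p \<equiv> w * fps_X"
  shows "(1 + p\<^sup>2) * (\<Sum>n\<le>N. gm_term n (w * fps_X\<^sup>2)) - (1 - p\<^sup>2) * (\<Sum>n\<le>N. gm_term n w) =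
     gm_term N w * (fps_X ^ (2 * N) * (1 - p\<^sup>2) * p * gm_inv N w) - p * (1 - p)"
proof (induction N)
  case 0
  have "gm_inv 0 w * (1 - p) = 1"
    using gm_inv_mult[of 0 w] by (simp add: p_def)
  then have "(1 - p\<^sup>2) * p * gm_inv 0 w = p * (1 + p)"
    by algebra
  moreover have "(1 + p\<^sup>2) - (1 - p\<^sup>2) = p * (1 + p) - p * (1 - p)"
    by algebra
  ultimately show ?case
    by (simp only: atMost_0 sum.insert finite.emptyI empty_iff not_False_eq_True sum.empty
        gm_term.simps mult_0_right power_0 mult_1_left mult_1_right add_0_right)
next
  case (Suc N)
  define A where "A = (fps_X ^ N :: complex fps)"
  define I where "I = gm_inv N w"
  define J where "J = gm_inv (Suc N) w"
  define q where "q = (fps_X :: complex fps)"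
  define T where "T = gm_term N w"
  have X: "fps_X ^ (2 * N) = A\<^sup>2" "fps_X ^ (2 * Suc N) = A\<^sup>2 * q\<^sup>2"
     "fps_X ^ (2 * N + 1) = A\<^sup>2 * q" "fps_X ^ (2 * Suc N + 1) = A\<^sup>2 * q ^ 3"
     "fps_X ^ (4 * N + 2) = A ^ 4 * q\<^sup>2"
    unfolding A_def q_def power_linear_exponents power_Suc
    by (rule refl | algebra)+
  have IH: "(1 + p\<^sup>2) * (\<Sum>n\<le>N. gm_term n (w * fps_X\<^sup>2)) - (1 - p\<^sup>2) * (\<Sum>n\<le>N. gm_term n w)
     = T * (A\<^sup>2 * (1 - p\<^sup>2) * p * I) - p * (1 - p)"
    using Suc.IH by (simp only: X I_def T_def)
  have 1: "gm_term (Suc N) w = T * (A\<^sup>2 * q * (w + A\<^sup>2 * q) * I)"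
    by (subst gm_term.simps(2)) (simp only: X I_def T_def)
  have 2: "gm_term (Suc N) (w * fps_X\<^sup>2) = T * (A ^ 4 * q\<^sup>2) * (1 - p\<^sup>2) * I * J"
    by (simp only: gm_term_shift X I_def J_def T_def p_def)
  have 3: "p = w * q" by (simp add: p_def q_def)
  have 4: "J * (1 - w * (A\<^sup>2 * q ^ 3)) = 1"
    using gm_inv_mult[of "Suc N" w] by (simp only: X J_def)
  have key: "(1 + p\<^sup>2) * (T * (A ^ 4 * q\<^sup>2) * (1 - p\<^sup>2) * I * J) - (1 - p\<^sup>2) * (T * (A\<^sup>2 * q * (w + A\<^sup>2 * q) * I))
     = T * (A\<^sup>2 * q * (w + A\<^sup>2 * q) * I) * (A\<^sup>2 * q\<^sup>2 * (1 - p\<^sup>2) * p * J) - T * (A\<^sup>2 * (1 - p\<^sup>2) * p * I)"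
  proof -
    \<comment> \<open>The difference of both sides is a multiple of J (1 - w q^(2N+3)) - 1, which is
      zero by the defining relation of J.\<close>
    have "(1 + (w * q)\<^sup>2) * (T * (A ^ 4 * q\<^sup>2) * (1 - (w * q)\<^sup>2) * I * J) - (1 - (w * q)\<^sup>2) * (T * (A\<^sup>2 * q * (w + A\<^sup>2 * q) * I))
      - (T * (A\<^sup>2 * q * (w + A\<^sup>2 * q) * I) * (A\<^sup>2 * q\<^sup>2 * (1 - (w * q)\<^sup>2) * (w * q) * J) - T * (A\<^sup>2 * (1 - (w * q)\<^sup>2) * (w * q) * I))
      = T * I * (1 - (w * q)\<^sup>2) * (A ^ 4 * q\<^sup>2) * (J * (1 - w * (A\<^sup>2 * q ^ 3)) - 1)"
      by algebra
    then show ?thesis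
      by (simp only: 3 4 diff_self mult_zero_right right_minus_eq)
  qed
  have "(1 + p\<^sup>2) * (\<Sum>n\<le>Suc N. gm_term n (w * fps_X\<^sup>2)) - (1 - p\<^sup>2) * (\<Sum>n\<le>Suc N. gm_term n w)
    = ((1 + p\<^sup>2) * (\<Sum>n\<le>N. gm_term n (w * fps_X\<^sup>2)) - (1 - p\<^sup>2) * (\<Sum>n\<le>N. gm_term n w))
      + ((1 + p\<^sup>2) * gm_term (Suc N) (w * fps_X\<^sup>2) - (1 - p\<^sup>2) * gm_term (Suc N) w)"
    by (simp only: sum.atMost_Suc distrib_left add_diff_add)
  also have "\<dots> = T * (A\<^sup>2 * q * (w + A\<^sup>2 * q) * I) * (A\<^sup>2 * q\<^sup>2 * (1 - p\<^sup>2) * p * J) - p * (1 - p)"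
    unfolding IH unfolding 1 2 key by (rule diff_add_diff_cancel_left)
  also have "\<dots> = gm_term (Suc N) w * (fps_X ^ (2 * Suc N) * (1 - p\<^sup>2) * p * gm_inv (Suc N) w) - p * (1 - p)"
    by (simp only: 1 X J_def)
  finally show ?case .
qed

section \<open>The infinite sum and its functional equation\<close>

definition gm_fun :: "complex fps \<Rightarrow> complex fps" where
  "gm_fun w = Abs_fps (\<lambda>N. \<Sum>n\<le>N. gm_term n w $ N)"

lemma gm_fun_nth:
  assumes "N \<le> M"
  shows "gm_fun w $ N = (\<Sum>n\<le>M. gm_term n w) $ N"
proof -
  have "gm_term n w $ N = 0" if "n > N" for n
  proof -
    have "N < n\<^sup>2" using that by (metis le_square less_le_trans power2_eq_square)
    then show ?thesis by (rule fps_X_power_dvd_nth_eq_0[OF gm_term_dvd])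
  qed
  then have "(\<Sum>n\<le>M. gm_term n w $ N) = (\<Sum>n\<le>N. gm_term n w $ N)"
    using assms by (intro sum.mono_neutral_right) auto
  then show ?thesis by (simp add: gm_fun_def fps_sum_nth)
qed

lemma gm_fun_shift:
  fixes w :: "complex fps"
  defines "p \<equiv> w * fps_X"
  shows "(1 + p\<^sup>2) * gm_fun (w * fps_X\<^sup>2) - (1 - p\<^sup>2) * gm_fun w = - p * (1 - p)"
proof (rule fps_ext)
  fix N
  \<comment> \<open>This cutoff is large enough for all coefficients up to N, and M^2 > N makes the
    remainder of the telescoped sum invisible.\<close>
  define M where "M = Suc N"
  have mult: "(c * gm_fun v) $ N = (c * (\<Sum>n\<le>M. gm_term n v)) $ N" for c v :: "complex fps"
    unfolding fps_mult_nth by (intro sum.cong refl arg_cong2[of _ _ _ _ "(*)"] gm_fun_nth) (simp add: M_def)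
  have "(gm_term M w * (fps_X ^ (2 * M) * (1 - p\<^sup>2) * p * gm_inv M w)) $ N = 0"
  proof (rule fps_X_power_dvd_nth_eq_0)
    show "fps_X ^ M\<^sup>2 dvd gm_term M w * (fps_X ^ (2 * M) * (1 - p\<^sup>2) * p * gm_inv M w)"
      by (rule dvd_mult2[OF gm_term_dvd])
    show "N < M\<^sup>2" by (simp add: M_def power2_eq_square)
  qed
  then show "((1 + p\<^sup>2) * gm_fun (w * fps_X\<^sup>2) - (1 - p\<^sup>2) * gm_fun w) $ N = (- p * (1 - p)) $ N"
    using arg_cong[OF gm_partial_sum_shift[of w M, folded p_def], of "\<lambda>f. f $ N"]
    by (simp only: mult fps_sub_nth mult_minus_left fps_neg_nth) simp
qed

definition gm_even :: "complex fps \<Rightarrow> complex fps" where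
  "gm_even w = gm_fun w + gm_fun (- w) - 1"

text \<open>Adding the equations at w and -w leaves 2 p^2 on the right, which is exactly cancelled
  by the constant 1 subtracted in \<open>gm_even\<close>; the equation becomes homogeneous.\<close>

lemma gm_even_shift:
  "(1 + (w * fps_X)\<^sup>2) * gm_even (w * fps_X\<^sup>2) = (1 - (w * fps_X)\<^sup>2) * gm_even w"
proof -
  define p where "p = w * fps_X"
  have lin: "(1 + p\<^sup>2) * (x' + y' - 1) - (1 - p\<^sup>2) * (x + y - 1) =
      ((1 + p\<^sup>2) * x' - (1 - p\<^sup>2) * x) + ((1 + p\<^sup>2) * y' - (1 - p\<^sup>2) * y) - 2 * p\<^sup>2" for x x' y y'
    by algebra
  have 1: "(1 + p\<^sup>2) * gm_fun (w * fps_X\<^sup>2) - (1 - p\<^sup>2) * gm_fun w = - p * (1 - p)"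
    using gm_fun_shift[of w] by (simp only: p_def)
  have 2: "(1 + p\<^sup>2) * gm_fun (- (w * fps_X\<^sup>2)) - (1 - p\<^sup>2) * gm_fun (- w) = - (- p) * (1 - (- p))"
    using gm_fun_shift[of "- w"] by (simp only: p_def mult_minus_left power2_minus)
  have "- p * (1 - p) + - (- p) * (1 - (- p)) - 2 * p\<^sup>2 = 0"
    by algebra
  then show ?thesis
    using lin[of "gm_fun (w * fps_X\<^sup>2)" "gm_fun (- (w * fps_X\<^sup>2))" "gm_fun w" "gm_fun (- w)"]
    unfolding 1 2 gm_even_def p_def[symmetric] by (simp only: diff_self right_minus_eq)
qed

section \<open>The invariant product and its value at w = 0\<close>

abbreviation fps_ii :: "complex fps" where "fps_ii \<equiv> fps_const \<i>"

lemma fps_ii_squared: "fps_ii\<^sup>2 = - 1"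
proof -
  have "fps_ii\<^sup>2 = fps_const (- 1)" unfolding fps_const_power by simp
  then show ?thesis by (simp only: fps_const_neg[symmetric] fps_const_1_eq_1)
qed

text \<open>Replacing w by i w turns p^2 into -p^2, so the factors 1 + p^2 and 1 - p^2 trade places
  and cancel in the product; both have constant coefficient 1.\<close>

lemma gm_even_prod_shift:
  "gm_even (w * fps_X\<^sup>2) * gm_even (fps_ii * (w * fps_X\<^sup>2)) = gm_even w * gm_even (fps_ii * w)"
proof -
  define p where "p = w * fps_X"
  have "(fps_ii * w * fps_X)\<^sup>2 = - p\<^sup>2"
    unfolding p_def power_mult_distrib fps_ii_squared by (simp only: mult_minus_left mult_1_left)
  then have 2: "(1 - p\<^sup>2) * gm_even (fps_ii * (w * fps_X\<^sup>2)) = (1 + p\<^sup>2) * gm_even (fps_ii * w)"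
    using gm_even_shift[of "fps_ii * w"]
    by (simp only: mult.assoc diff_minus_eq_add add_uminus_conv_diff)
  have 1: "(1 + p\<^sup>2) * gm_even (w * fps_X\<^sup>2) = (1 - p\<^sup>2) * gm_even w"
    using gm_even_shift[of w] by (simp only: p_def)
  have nz: "(1 + p\<^sup>2) * (1 - p\<^sup>2) \<noteq> 0"
  proof -
    have "((1 + p\<^sup>2) * (1 - p\<^sup>2)) $ 0 = 1" by (simp add: p_def power2_eq_square)
    then show ?thesis by (metis fps_zero_nth zero_neq_one)
  qed
  have "((1 + p\<^sup>2) * (1 - p\<^sup>2)) * (gm_even (w * fps_X\<^sup>2) * gm_even (fps_ii * (w * fps_X\<^sup>2))) =
        ((1 + p\<^sup>2) * (1 - p\<^sup>2)) * (gm_even w * gm_even (fps_ii * w))"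
  proof -
    have "(a * b) * (x * y) = (a * b) * (x' * y')" if "a * x = b * x'" "b * y = a * y'"
      for a b x y x' y' :: "complex fps"
    proof -
      have "(a * b) * (x * y) = (a * x) * (b * y)" by (simp only: mult_ac)
      also have "\<dots> = (a * b) * (x' * y')" unfolding that by (simp only: mult_ac)
      finally show ?thesis .
    qed
    then show ?thesis using 1 2 .
  qed
  then show ?thesis using mult_left_cancel[OF nz] by iprover
qed

lemma gm_inv_dvd_diff:
  assumes "d dvd w"
  shows "d dvd gm_inv n w - 1"
proof -
  have "gm_inv n w - 1 = w * (fps_X ^ (2 * n + 1) * gm_inv n w)"
    using gm_inv_mult[of n w] by (simp add: algebra_simps)
  then show ?thesis using assms by simp
qed

lemma gm_inv_0 [simp]: "gm_inv n 0 = 1"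
  by (simp add: gm_inv_def)

lemma dvd_diff_mult:
  fixes d :: "'a::comm_ring_1"
  assumes "d dvd f - f'" "d dvd g - g'"
  shows "d dvd f * g - f' * g'"
proof -
  have "f * g - f' * g' = (f - f') * g + f' * (g - g')" by (simp add: algebra_simps)
  then show ?thesis using assms by simp
qed

lemma gm_term_dvd_diff:
  assumes "d dvd w"
  shows "d dvd gm_term n w - gm_term n 0"
proof (induction n)
  case (Suc n)
  show ?case unfolding gm_term.simps
    by (intro dvd_diff_mult Suc) (use assms gm_inv_dvd_diff[OF assms] in simp_all)
qed simp

text \<open>This is q-adic continuity at w = 0: modulo w, every \<open>gm_inv\<close> is 1 and hence
  every term agrees with its value at 0.\<close>

lemma gm_even_nth_eq_0:
  assumes "fps_X ^ m dvd w" "N < m"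
  shows "gm_even w $ N = gm_even 0 $ N"
proof -
  have "gm_fun v $ N = gm_fun 0 $ N" if "fps_X ^ m dvd v" for v
  proof -
    have "(gm_term n v - gm_term n 0) $ N = 0" for n
      using fps_X_power_dvd_nth_eq_0[OF gm_term_dvd_diff[OF that]] assms(2) .
    then show ?thesis by (simp add: gm_fun_def)
  qed
  from this[of w] this[of "- w"] have "gm_fun w $ N = gm_fun 0 $ N" "gm_fun (- w) $ N = gm_fun 0 $ N"
    using assms by simp_all
  then show ?thesis by (simp only: gm_even_def fps_sub_nth fps_add_nth minus_zero)
qed

text \<open>By invariance both arguments may be multiplied by q^(2m); for large m they are
  q-adically close to 0, so each coefficient of the product is the one at w = 0.\<close>

lemma gm_even_prod: "gm_even 1 * gm_even fps_ii = (gm_even 0)\<^sup>2"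
proof (rule fps_ext)
  fix N
  have iter: "gm_even (fps_X ^ (2 * m)) * gm_even (fps_ii * fps_X ^ (2 * m)) = gm_even 1 * gm_even fps_ii" for m
  proof (induction m)
    case (Suc m)
    have "fps_X ^ (2 * Suc m) = (fps_X ^ (2 * m) * fps_X\<^sup>2 :: complex fps)"
      by (simp only: power_add[symmetric] mult_Suc_right add.commute)
    then show ?case using Suc gm_even_prod_shift[of "fps_X ^ (2 * m)"] by (simp only:)
  qed simp
  \<comment> \<open>The exponent 2 (N + 1) exceeds every index i \<le> N, so both arguments count as
    0 up to degree N.\<close>
  have "gm_even v $ i = gm_even 0 $ i" if "i \<le> N" "v = fps_X ^ (2 * Suc N) \<or> v = fps_ii * fps_X ^ (2 * Suc N)" for i v
    by (rule gm_even_nth_eq_0[of "2 * Suc N"]) (use that in auto)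
  then have "(gm_even (fps_X ^ (2 * Suc N)) * gm_even (fps_ii * fps_X ^ (2 * Suc N))) $ N
      = (gm_even 0 * gm_even 0) $ N"
    unfolding fps_mult_nth by (intro sum.cong refl arg_cong2[of _ _ _ _ "(*)"]) (metis atLeastAtMost_iff diff_le_self)+
  then show "(gm_even 1 * gm_even fps_ii) $ N = (gm_even 0)\<^sup>2 $ N"
    by (simp only: iter power2_eq_square)
qed

section \<open>The theta series and sums of two squares\<close>

definition int_sqrts :: "nat \<Rightarrow> int set" where
  "int_sqrts n = {m. m\<^sup>2 = int n}"

text \<open>Counting signed roots keeps products combinatorial: their coefficients count lattice
  points.\<close>

definition theta :: "int fps" where
  "theta = Abs_fps (\<lambda>n. int (card (int_sqrts n)))"

definition theta_neg :: "int fps" where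
  "theta_neg = theta oo (- fps_X)"

lemma theta_neg_nth: "theta_neg $ n = (-1) ^ n * theta $ n"
  by (simp add: theta_neg_def fps_compose_uminus')

lemma int_sqrts_square: "int_sqrts (k\<^sup>2) = {int k, - int k}"
  unfolding int_sqrts_def by (auto simp: power2_eq_iff)

lemma int_sqrts_nonsquare: "\<nexists>k. n = k\<^sup>2 \<Longrightarrow> int_sqrts n = {}"
proof -
  assume n: "\<nexists>k. n = k\<^sup>2"
  have "n = (nat \<bar>m\<bar>)\<^sup>2" if "m\<^sup>2 = int n" for m
    using that by (metis nat_int nat_power_eq power2_abs abs_ge_zero)
  then show ?thesis using n by (auto simp: int_sqrts_def)
qed

lemma finite_int_sqrts [simp]: "finite (int_sqrts n)"
  by (cases "\<exists>k. n = k\<^sup>2") (auto simp: int_sqrts_square int_sqrts_nonsquare)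

lemma theta_nth_square: "theta $ (k\<^sup>2) = (if k = 0 then 1 else 2)"
  by (simp add: theta_def int_sqrts_square)

lemma theta_nth_nonsquare: "\<nexists>k. n = k\<^sup>2 \<Longrightarrow> theta $ n = 0"
  by (simp add: theta_def int_sqrts_nonsquare)

section \<open>Dilation and section of power series\<close>

lemma fps_nth_compose_X_power:
  fixes f :: "'a::comm_ring_1 fps"
  assumes "d > 0"
  shows "(f oo fps_X ^ d) $ n = (if d dvd n then f $ (n div d) else 0)"
proof -
  have "(f oo fps_X ^ d) $ n = (\<Sum>i = 0..n. f $ i * (if n = d * i then 1 else 0))"
    by (simp add: fps_compose_nth flip: power_mult)
  also have "\<dots> = (\<Sum>i\<in>(if d dvd n then {n div d} else {}). f $ i)"
    by (rule sum.mono_neutral_cong_right) (use assms in \<open>auto split: if_splits\<close>)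
  finally show ?thesis by simp
qed

definition fps_section :: "nat \<Rightarrow> 'a::zero fps \<Rightarrow> 'a fps" where
  "fps_section k f = Abs_fps (\<lambda>n. f $ (k * n))"

lemma fps_section_nth [simp]: "fps_section k f $ n = f $ (k * n)"
  by (simp add: fps_section_def)

lemma fps_section_add: "fps_section k (f + g) = fps_section k f + fps_section k g"
  by (simp add: fps_eq_iff)

text \<open>A series in q^k vanishes off the multiples of k, so the convolution at k n reduces to a
  convolution at n.\<close>

lemma fps_section_compose_mult:
  fixes f g :: "'a::comm_ring_1 fps"
  assumes "k > 0"
  shows "fps_section k ((g oo fps_X ^ k) * f) = g * fps_section k f"
proof (rule fps_ext)
  fix n
  have "(\<Sum>i = 0..k * n. (g oo fps_X ^ k) $ i * f $ (k * n - i)) =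
        (\<Sum>i\<in>(*) k ` {0..n}. (g oo fps_X ^ k) $ i * f $ (k * n - i))"
    by (rule sum.mono_neutral_right)
       (use assms in \<open>auto simp: fps_nth_compose_X_power elim!: dvdE\<close>)
  also have "\<dots> = (\<Sum>i = 0..n. g $ i * f $ (k * (n - i)))"
    using assms by (subst sum.reindex) (auto simp: inj_on_def fps_nth_compose_X_power diff_mult_distrib2)
  finally show "fps_section k ((g oo fps_X ^ k) * f) $ n = (g * fps_section k f) $ n"
    by (simp add: fps_mult_nth)
qed

lemma fps_section_compose: 
  "k > 0 \<Longrightarrow> fps_section k (g oo fps_X ^ k) = (g :: 'a::comm_ring_1 fps)"
  by (simp add: fps_eq_iff fps_nth_compose_X_power)

section \<open>Identities from representations by two squares\<close>

definition two_squares :: "nat \<Rightarrow> (int \<times> int) set" where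
  "two_squares n = {(m, l). m\<^sup>2 + l\<^sup>2 = int n}"

text \<open>Expanding the product sorts the pairs (m, l) by m^2. The weights c and d are later set
  to 1 or -1, so one computation serves all products of \<open>theta\<close> and
  \<open>theta_neg\<close>.\<close>

lemma theta_mult_nth:
  fixes c d :: int
  shows "(Abs_fps (\<lambda>n. c ^ n * theta $ n) * Abs_fps (\<lambda>n. d ^ n * theta $ n)) $ N =
     (\<Sum>(m, l)\<in>two_squares N. c ^ nat (m\<^sup>2) * d ^ nat (l\<^sup>2))"
    and finite_two_squares: "finite (two_squares N)"
proof -
  have cell: "{x \<in> two_squares N. nat ((fst x)\<^sup>2) = i} = int_sqrts i \<times> int_sqrts (N - i)" if "i \<le> N" for i
    using that by (auto simp: two_squares_def int_sqrts_def of_nat_diff)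
  have range: "nat ((fst x)\<^sup>2) \<in> {0..N}" if "x \<in> two_squares N" for x
  proof -
    have "(fst x)\<^sup>2 \<le> (fst x)\<^sup>2 + (snd x)\<^sup>2" by simp
    also have "\<dots> = int N" using that by (simp add: two_squares_def case_prod_unfold)
    finally have "(fst x)\<^sup>2 \<le> int N" .
    then show ?thesis by simp
  qed
  have "two_squares N \<subseteq> (\<Union>i\<in>{0..N}. {x \<in> two_squares N. nat ((fst x)\<^sup>2) = i})"
    using range by auto
  then show fin: "finite (two_squares N)"
    by (rule finite_subset) (use cell in auto)
  have "(\<Sum>(m, l)\<in>two_squares N. c ^ nat (m\<^sup>2) * d ^ nat (l\<^sup>2)) =
     (\<Sum>i\<in>{0..N}. \<Sum>x\<in>{x \<in> two_squares N. nat ((fst x)\<^sup>2) = i}. (case x of (m, l) \<Rightarrow> c ^ nat (m\<^sup>2) * d ^ nat (l\<^sup>2)))"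
    by (rule sum.group[symmetric]) (use fin range in auto)
  also have "\<dots> = (\<Sum>i\<in>{0..N}. \<Sum>x\<in>int_sqrts i \<times> int_sqrts (N - i). c ^ i * d ^ (N - i))"
    by (intro sum.cong) (auto simp: cell, auto simp: int_sqrts_def nat_diff_distrib)
  also have "\<dots> = (\<Sum>i\<in>{0..N}. (c ^ i * theta $ i) * (d ^ (N - i) * theta $ (N - i)))"
    by (intro sum.cong) (auto simp: theta_def card_cartesian_product)
  finally show "(Abs_fps (\<lambda>n. c ^ n * theta $ n) * Abs_fps (\<lambda>n. d ^ n * theta $ n)) $ N =
     (\<Sum>(m, l)\<in>two_squares N. c ^ nat (m\<^sup>2) * d ^ nat (l\<^sup>2))"
    by (simp add: fps_mult_nth)
qed

lemma theta_Abs: "Abs_fps (\<lambda>n. 1 ^ n * theta $ n) = theta" "Abs_fps (\<lambda>n. (- 1) ^ n * theta $ n) = theta_neg"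
  by (simp_all add: fps_eq_iff theta_neg_nth)

lemma minus_one_power_nat_square: "(- 1 :: int) ^ nat (m\<^sup>2) = (if even m then 1 else - 1)"
  by (simp add: even_nat_iff uminus_power_if)

text \<open>On Gaussian integers this is multiplication by 1 - i followed by conjugation. It is onto
  because both coordinates of a representation of an even number have the same parity.\<close>

lemma bij_betw_two_squares:
  "bij_betw (\<lambda>(m, l). (m + l, m - l)) (two_squares K) (two_squares (2 * K))"
proof (rule bij_betw_imageI)
  show "inj_on (\<lambda>(m, l). (m + l, m - l)) (two_squares K)"
    by (auto simp: inj_on_def)
  show "(\<lambda>(m, l). (m + l, m - l)) ` two_squares K = two_squares (2 * K)"
  proof (intro equalityI subsetI)
    fix x assume "x \<in> two_squares (2 * K)"
    then obtain a b where x: "x = (a, b)" "a\<^sup>2 + b\<^sup>2 = 2 * int K" by (auto simp: two_squares_def)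
    then have "even (a\<^sup>2 + b\<^sup>2)" by simp
    then have "even (a + b)" by simp
    then obtain m where m: "a + b = 2 * m" by blast
    have "x = (m + (a - m), m - (a - m))" using x(1) m by simp
    moreover have "m\<^sup>2 + (a - m)\<^sup>2 = int K"
    proof -
      have "b = 2 * m - a" using m by simp
      then have "2 * (m\<^sup>2 + (a - m)\<^sup>2) = 2 * int K"
        using x(2) by algebra
      then show ?thesis by simp
    qed
    ultimately show "x \<in> (\<lambda>(m, l). (m + l, m - l)) ` two_squares K"
      by (intro image_eqI[of _ _ "(m, a - m)"]) (simp_all add: two_squares_def)
  qed (auto simp: two_squares_def power2_eq_square algebra_simps)
qed

lemma theta_square_nth_double: "(theta\<^sup>2) $ (2 * K) = (theta\<^sup>2) $ K"
  using theta_mult_nth(1)[of 1 1] bij_betw_same_card[OF bij_betw_two_squares[of K]]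
  by (simp add: theta_Abs[unfolded power_one mult_1_left] power2_eq_square case_prod_unfold)

lemma theta_neg_square_nth: "(theta_neg\<^sup>2) $ n = (- 1) ^ n * (theta\<^sup>2) $ n"
proof -
  have "theta_neg\<^sup>2 = theta\<^sup>2 oo (- fps_X)"
    unfolding theta_neg_def by (rule fps_compose_power) simp
  then show ?thesis by (simp add: fps_compose_uminus')
qed

text \<open>Odd coefficients cancel and even ones double; doubling n does not change the number of
  representations by two squares.\<close>

lemma theta_square_add: "theta\<^sup>2 + theta_neg\<^sup>2 = 2 * (theta\<^sup>2 oo fps_X\<^sup>2)"
proof (rule fps_ext)
  fix n
  have "(2 * (theta\<^sup>2 oo fps_X\<^sup>2)) $ n = 2 * (theta\<^sup>2 oo fps_X\<^sup>2) $ n"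
    by (metis fps_add_nth mult_2)
  then show "(theta\<^sup>2 + theta_neg\<^sup>2) $ n = (2 * (theta\<^sup>2 oo fps_X\<^sup>2)) $ n"
    by (auto simp: theta_neg_square_nth fps_nth_compose_X_power theta_square_nth_double elim!: evenE oddE)
qed

text \<open>The coefficient at n sums the sign (-1)^l over m^2 + l^2 = n. For odd n, swapping m and
  l reverses the sign and the sum is zero. For n = 2 K, the bijection with the representations of K
  turns the sign into (-1)^(m-l) = (-1)^m (-1)^l.\<close>

lemma theta_mult_theta_neg: "theta * theta_neg = theta_neg\<^sup>2 oo fps_X\<^sup>2"
proof (rule fps_ext)
  fix n
  have lhs: "(theta * theta_neg) $ n = (\<Sum>(m, l)\<in>two_squares n. if even l then 1 else - 1)"
    using theta_mult_nth(1)[of 1 "- 1" n] unfolding theta_Abs by (simp add: minus_one_power_nat_square)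
  have swap: "(\<Sum>(m, l)\<in>two_squares n. if even l then 1 else - 1) =
      (\<Sum>(m, l)\<in>two_squares n. if even m then 1 else - 1 :: int)"
    by (rule sum.reindex_bij_witness[of _ "\<lambda>(a, b). (b, a)" "\<lambda>(a, b). (b, a)"])
       (auto simp: two_squares_def)
  show "(theta * theta_neg) $ n = (theta_neg\<^sup>2 oo fps_X\<^sup>2) $ n"
  proof (cases "even n")
    case True
    then obtain K where n: "n = 2 * K" by blast
    have "(\<Sum>(m, l)\<in>two_squares n. if even l then 1 else - 1 :: int) =
        (\<Sum>x\<in>two_squares K. (\<lambda>(m, l). if even l then 1 else - 1) ((\<lambda>(m, l). (m + l, m - l)) x))"
      unfolding n by (rule sum.reindex_bij_betw[OF bij_betw_two_squares, symmetric])
    also have "\<dots> = (\<Sum>(m, l)\<in>two_squares K. (- 1) ^ nat (m\<^sup>2) * (- 1) ^ nat (l\<^sup>2))"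
      unfolding minus_one_power_nat_square by (intro sum.cong) auto
    also have "\<dots> = (theta_neg\<^sup>2) $ K"
      using theta_mult_nth(1)[of "- 1" "- 1" K] unfolding theta_Abs by (simp add: power2_eq_square)
    finally show ?thesis
      unfolding lhs by (simp add: fps_nth_compose_X_power n)
  next
    case False
    have "(\<Sum>(m, l)\<in>two_squares n. if even l then 1 else - 1 :: int) =
        (\<Sum>(m, l)\<in>two_squares n. - (if even m then 1 else - 1))"
    proof (intro sum.cong refl)
      fix x assume "x \<in> two_squares n"
      then obtain m l where x: "x = (m, l)" "m\<^sup>2 + l\<^sup>2 = int n" by (auto simp: two_squares_def)
      then have "odd (m\<^sup>2 + l\<^sup>2)" using False by simp
      then have "odd (m + l)" by simp
      then show "(case x of (m, l) \<Rightarrow> (if even l then (1::int) else - 1)) = (case x of (m, l) \<Rightarrow> - (if even m then 1 else - 1))"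
        using x(1) by auto
    qed
    also have "\<dots> = - (\<Sum>(m, l)\<in>two_squares n. if even m then 1 else - 1 :: int)"
      by (simp add: case_prod_unfold sum_negf)
    finally have "(theta * theta_neg) $ n = 0" using swap unfolding lhs by simp
    then show ?thesis using False by (simp add: fps_nth_compose_X_power)
  qed
qed

section \<open>The even part of the generating function\<close>

text \<open>The telescoping works with i and inverses, the divisibility with integers. This
  embedding is an injective ring homomorphism, so identities descend from one to the other.\<close>

definition fps_of_int_coeffs :: "int fps \<Rightarrow> complex fps" where
  "fps_of_int_coeffs f = Abs_fps (\<lambda>n. of_int (f $ n))"

lemma fps_of_int_coeffs_nth [simp]: "fps_of_int_coeffs f $ n = of_int (f $ n)"
  by (simp add: fps_of_int_coeffs_def)

lemma fps_of_int_coeffs_mult: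
  "fps_of_int_coeffs (f * g) = fps_of_int_coeffs f * fps_of_int_coeffs g"
  by (simp add: fps_eq_iff fps_mult_nth)

lemma fps_of_int_coeffs_add:
  "fps_of_int_coeffs (f + g) = fps_of_int_coeffs f + fps_of_int_coeffs g"
  by (simp add: fps_eq_iff)

lemma fps_of_int_coeffs_diff:
  "fps_of_int_coeffs (f - g) = fps_of_int_coeffs f - fps_of_int_coeffs g"
  by (simp add: fps_eq_iff)

lemma fps_of_int_coeffs_1 [simp]: "fps_of_int_coeffs 1 = 1"
  by (simp add: fps_eq_iff)

lemma fps_of_int_coeffs_X [simp]: "fps_of_int_coeffs fps_X = fps_X"
  by (simp add: fps_eq_iff fps_X_def)

lemma fps_of_int_coeffs_power: "fps_of_int_coeffs (f ^ n) = fps_of_int_coeffs f ^ n"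
  by (induction n) (simp_all add: fps_of_int_coeffs_mult)

lemma fps_of_int_coeffs_inject [simp]: "fps_of_int_coeffs f = fps_of_int_coeffs g \<longleftrightarrow> f = g"
  by (simp add: fps_eq_iff)

lemma gm_term_mult:
  "gm_term n w * (\<Prod>i<n. 1 - w * fps_X ^ (2 * i + 1)) = fps_X ^ n\<^sup>2 * (\<Prod>i<n. w + fps_X ^ (2 * i + 1))"
proof (induction n)
  case (Suc n)
  have X: "fps_X ^ (Suc n)\<^sup>2 = (fps_X ^ n\<^sup>2 * fps_X ^ (2 * n + 1) :: complex fps)"
    unfolding power_add[symmetric] by (simp add: power2_eq_square)
  have "gm_term (Suc n) w * (\<Prod>i<Suc n. 1 - w * fps_X ^ (2 * i + 1)) =
     (gm_term n w * (\<Prod>i<n. 1 - w * fps_X ^ (2 * i + 1))) * (fps_X ^ (2 * n + 1) * (w + fps_X ^ (2 * n + 1)))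
       * (gm_inv n w * (1 - w * fps_X ^ (2 * n + 1)))"
    unfolding gm_term.simps prod.lessThan_Suc by (simp only: mult_ac)
  also have "\<dots> = fps_X ^ (Suc n)\<^sup>2 * (\<Prod>i<Suc n. w + fps_X ^ (2 * i + 1))"
    unfolding Suc.IH gm_inv_mult X prod.lessThan_Suc by (simp only: mult_ac mult_1_right mult_1_left)
  finally show ?case .
qed simp

lemma qpoch_odd: "qpoch a (fps_X\<^sup>2) n = (\<Prod>i<n. 1 - a * fps_X ^ (2 * i) :: 'a::comm_ring_1 fps)"
  unfolding qpoch_def by (rule prod.reindex_bij_witness[of _ Suc "\<lambda>i. i - 1"]) (auto simp flip: power_mult)

lemma fps_of_int_coeffs_prod:
  "fps_of_int_coeffs (\<Prod>i<n. f i) = (\<Prod>i<n. fps_of_int_coeffs (f i))" for n :: nat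
  by (induction n) (simp_all add: fps_of_int_coeffs_mult)

text \<open>Both series give the same product with the nonzero denominator D, which can be
  cancelled.\<close>

lemma gm_term_1: "gm_term n 1 = fps_of_int_coeffs (v0_summand n)"
proof -
  define D where "D = (\<Prod>i<n. 1 - fps_X ^ (2 * i + 1) :: complex fps)"
  have D: "fps_of_int_coeffs (qpoch fps_X (fps_X\<^sup>2) n) = D"
    by (simp add: qpoch_odd fps_of_int_coeffs_prod fps_of_int_coeffs_diff fps_of_int_coeffs_mult
        fps_of_int_coeffs_power D_def)
  have "fps_of_int_coeffs (v0_summand n) * D = fps_X ^ n\<^sup>2 * (\<Prod>i<n. 1 + fps_X ^ (2 * i + 1))"
    using arg_cong[OF v0_summand_mult[of n], of fps_of_int_coeffs]
    by (simp add: qpoch_odd fps_of_int_coeffs_prod fps_of_int_coeffs_add fps_of_int_coeffs_mult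
        fps_of_int_coeffs_power flip: D)
  moreover have "gm_term n 1 * D = fps_X ^ n\<^sup>2 * (\<Prod>i<n. 1 + fps_X ^ (2 * i + 1))"
    using gm_term_mult[of n 1] by (simp add: D_def)
  moreover have "D \<noteq> 0"
    unfolding D[symmetric] using qpoch_fps_X_nth_0[of n]
    by (metis fps_of_int_coeffs_nth fps_zero_nth of_int_1 zero_neq_one)
  ultimately show ?thesis by (metis mult_right_cancel)
qed

text \<open>Under q to -q every odd power A changes sign, and -A (1 - A) = A (-1 + A) is exactly the
  numerator at w = -1.\<close>

lemma gm_term_uminus_1: "gm_term n (- 1) = gm_term n 1 oo (- fps_X)"
proof (induction n)
  case (Suc n)
  define A where "A = (fps_X ^ (2 * n + 1) :: complex fps)"
  have A: "A oo (- fps_X) = - A"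
    unfolding A_def by (subst fps_compose_power[symmetric]) (simp_all add: power_minus_odd)
  have I: "gm_inv n 1 oo (- fps_X) = gm_inv n (- 1)"
    unfolding gm_inv_def A_def[symmetric]
    by (subst fps_inverse_compose) (simp_all add: fps_compose_sub_distrib A, simp add: A_def)
  have "gm_term (Suc n) 1 oo (- fps_X) = gm_term n (- 1) * ((- A) * (1 + (- A)) * gm_inv n (- 1))"
    unfolding gm_term.simps A_def[symmetric]
    by (simp add: fps_compose_mult_distrib fps_compose_add_distrib Suc.IH A I)
  also have "(- A) * (1 + (- A)) = A * (- 1 + A)" by (simp add: algebra_simps)
  finally show ?case by (simp only: gm_term.simps A_def)
qed simp

text \<open>The integer form of S(1): with F the generating function of \<open>v0\<close> it is F(q)
  + F(-q) - 1.\<close>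

definition v0_even :: "int fps" where
  "v0_even = Abs_fps (\<lambda>N. (1 + (- 1) ^ N) * v0 N - (if N = 0 then 1 else 0))"

lemma gm_even_1: "gm_even 1 = fps_of_int_coeffs v0_even"
proof (rule fps_ext)
  fix N
  have "gm_fun 1 $ N = of_int (v0 N)"
    by (simp only: gm_fun_def gm_term_1 v0_eq_sum fps_nth_Abs_fps fps_of_int_coeffs_nth of_int_sum)
  moreover have "gm_fun (- 1) $ N = (- 1) ^ N * of_int (v0 N)"
    by (simp only: gm_fun_def gm_term_uminus_1 fps_compose_uminus' gm_term_1 v0_eq_sum
        fps_nth_Abs_fps fps_of_int_coeffs_nth of_int_sum sum_distrib_left)
  ultimately show "gm_even 1 $ N = fps_of_int_coeffs v0_even $ N"
    by (simp only: gm_even_def v0_even_def fps_nth_Abs_fps fps_of_int_coeffs_nth fps_sub_nth fps_add_nth fps_one_nth)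
      (simp add: distrib_right)
qed

lemma sum_atMost_eq_square:
  fixes f :: "nat \<Rightarrow> 'a::comm_monoid_add"
  shows "(\<Sum>n\<le>k\<^sup>2. if k\<^sup>2 = n\<^sup>2 then f n else 0) = f k"
proof -
  have "(\<Sum>n\<le>k\<^sup>2. if k\<^sup>2 = n\<^sup>2 then f n else 0) = (\<Sum>n\<le>k\<^sup>2. if n = k then f n else 0)"
    by (intro sum.cong) auto
  also have "\<dots> = f k" using le_square[of k] by (simp add: power2_eq_square)
  finally show ?thesis .
qed

lemma gm_term_0: "gm_term n 0 = (fps_X ^ n\<^sup>2)\<^sup>2"
proof (induction n)
  case (Suc n)
  define A where "A = (fps_X ^ (2 * n + 1) :: complex fps)"
  have X: "fps_X ^ (Suc n)\<^sup>2 = (fps_X ^ n\<^sup>2 * A :: complex fps)"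
    unfolding A_def power_add[symmetric] by (simp add: power2_eq_square)
  show ?case
    unfolding gm_term.simps Suc.IH X A_def[symmetric] gm_inv_0 power_mult_distrib
    by (simp only: power2_eq_square[of A] add_0_left mult_1_right)
qed simp

text \<open>At w = 0 the terms are q^(2 n^2); twice their sum over n \<ge> 0, minus 1, is the sum
  over all integers.\<close>

lemma gm_even_0: "gm_even 0 = fps_of_int_coeffs (theta oo fps_X\<^sup>2)"
proof (rule fps_ext)
  fix N
  have nth: "gm_fun 0 $ N = (\<Sum>n\<le>N. if N = 2 * n\<^sup>2 then 1 else 0)"
    by (simp add: gm_fun_def gm_term_0 power_mult[symmetric] mult.commute)
  have even: "gm_even 0 $ N = 2 * gm_fun 0 $ N - (if N = 0 then 1 else 0)"
    by (simp only: gm_even_def fps_sub_nth fps_add_nth minus_zero fps_one_nth mult_2)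
  show "gm_even 0 $ N = fps_of_int_coeffs (theta oo fps_X\<^sup>2) $ N"
  proof (cases "\<exists>k. N = 2 * k\<^sup>2")
    case True
    then obtain k where N: "N = 2 * k\<^sup>2" by blast
    have "(\<Sum>n\<le>N. if N = 2 * n\<^sup>2 then 1 else 0) = (\<Sum>n\<le>k\<^sup>2. if k\<^sup>2 = n\<^sup>2 then 1 else 0 :: complex)"
      unfolding N by (rule sum.mono_neutral_cong_right) (auto simp: power2_eq_square)
    then show ?thesis unfolding even nth sum_atMost_eq_square
      by (simp add: fps_nth_compose_X_power N theta_nth_square)
  next
    case False
    then have "theta $ (N div 2) = 0" if "even N"
      using that by (intro theta_nth_nonsquare) (metis dvd_mult_div_cancel)
    moreover have "gm_fun 0 $ N = 0"
      unfolding nth using False by (intro sum.neutral) auto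
    moreover have "N \<noteq> 0" using False by (metis mult_0_right zero_power2)
    ultimately show ?thesis unfolding even by (simp add: fps_nth_compose_X_power)
  qed
qed

text \<open>If c^2 = -1 then c + A = c (1 - c A), so each quotient (c + A) / (1 - c A) collapses to
  the constant c.\<close>

lemma gm_term_const:
  assumes "c\<^sup>2 = - 1"
  shows "gm_term n (fps_const c) = fps_const (c ^ n) * fps_X ^ n\<^sup>2"
proof (induction n)
  case (Suc n)
  define A where "A = (fps_X ^ (2 * n + 1) :: complex fps)"
  have X: "fps_X ^ (Suc n)\<^sup>2 = (fps_X ^ n\<^sup>2 * A :: complex fps)"
    unfolding power_add[symmetric] A_def by (simp add: power2_eq_square)
  have "fps_const c * fps_const c = - 1"
    using assms by (simp only: fps_const_mult power2_eq_square) (simp only: fps_const_neg[symmetric] fps_const_1_eq_1)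
  then have "fps_const c * (fps_const c * A) = - A"
    by (simp only: mult.assoc[symmetric] mult_minus_left mult_1_left)
  then have "fps_const c + A = fps_const c * (1 - fps_const c * A)"
    by (simp only: right_diff_distrib mult_1_right diff_minus_eq_add)
  then have "(fps_const c + A) * gm_inv n (fps_const c) = fps_const c * (gm_inv n (fps_const c) * (1 - fps_const c * A))"
    by (simp only: mult_ac)
  also have "\<dots> = fps_const c"
    unfolding A_def gm_inv_mult by simp
  finally have "(fps_const c + A) * gm_inv n (fps_const c) = fps_const c" .
  then have "gm_term (Suc n) (fps_const c) = fps_const (c ^ n) * fps_X ^ n\<^sup>2 * (A * fps_const c)"
    unfolding gm_term.simps Suc.IH A_def[symmetric] by (simp only: mult.assoc)
  then show ?case unfolding X power_Suc fps_const_mult[symmetric] by (simp only: mult_ac)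
qed simp

lemma ii_power_add: "\<i> ^ k + (- \<i>) ^ k = (if odd k then 0 else 2 * (- 1) ^ (k div 2))"
proof (cases "even k")
  case True
  then obtain j where "k = 2 * j" by blast
  then show ?thesis by (simp add: power_mult)
qed (simp add: power_minus_odd)

text \<open>The terms at i and -i combine to i^k + (-i)^k, which is zero for odd k and 2 (-1)^j for
  k = 2 j; what remains is the alternating theta series in q^4.\<close>

lemma gm_even_ii: "gm_even fps_ii = fps_of_int_coeffs (theta_neg oo fps_X ^ 4)"
proof (rule fps_ext)
  fix N
  have nth: "gm_fun (fps_const c) $ N = (\<Sum>n\<le>N. if N = n\<^sup>2 then c ^ n else 0)" if "c\<^sup>2 = - 1" for c
    unfolding gm_fun_def gm_term_const[OF that] by (auto intro!: sum.cong)
  have even: "gm_even fps_ii $ N = gm_fun (fps_const \<i>) $ N + gm_fun (fps_const (- \<i>)) $ N - (if N = 0 then 1 else 0)"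
    by (simp only: gm_even_def fps_sub_nth fps_add_nth fps_const_neg fps_one_nth)
  have [simp]: "\<i>\<^sup>2 = - 1" "(- \<i>)\<^sup>2 = - 1" by simp_all
  show "gm_even fps_ii $ N = fps_of_int_coeffs (theta_neg oo fps_X ^ 4) $ N"
  proof (cases "\<exists>k. N = k\<^sup>2")
    case True
    then obtain k where N: "N = k\<^sup>2" by blast
    have lhs: "gm_even fps_ii $ N = \<i> ^ k + (- \<i>) ^ k - (if N = 0 then 1 else 0)"
      by (simp only: even nth \<open>\<i>\<^sup>2 = - 1\<close> \<open>(- \<i>)\<^sup>2 = - 1\<close>) (simp only: N sum_atMost_eq_square)
    show ?thesis
    proof (cases "even k")
      case True
      then obtain j where k: "k = 2 * j" by blast
      have "N = 4 * j\<^sup>2" by (simp add: N k)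
      then show ?thesis unfolding lhs ii_power_add
        by (auto simp: fps_nth_compose_X_power theta_neg_nth theta_nth_square k minus_one_power_iff)
    next
      case False
      then have "odd N" by (simp add: N)
      then have "\<not> 4 dvd N" "N \<noteq> 0" by presburger+
      then show ?thesis using False unfolding lhs ii_power_add by (simp add: fps_nth_compose_X_power)
    qed
  next
    case False
    have "theta $ (N div 4) = 0" if "4 dvd N"
    proof (rule theta_nth_nonsquare)
      show "\<nexists>k. N div 4 = k\<^sup>2"
      proof
        assume "\<exists>k. N div 4 = k\<^sup>2"
        then obtain k where "N div 4 = k\<^sup>2" by blast
        then have "N = (2 * k)\<^sup>2" using that by auto
        then show False using False by blast
      qed
    qed
    moreover have "gm_even fps_ii $ N = 0"
    proof -
      have "N \<noteq> 0" using False by (metis zero_power2)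
      then show ?thesis using False by (simp add: even nth)
    qed
    ultimately show ?thesis by (simp add: fps_nth_compose_X_power theta_neg_nth)
  qed
qed

lemma v0_even_mult: "v0_even * (theta_neg oo fps_X ^ 4) = (theta oo fps_X\<^sup>2)\<^sup>2"
proof -
  have "fps_of_int_coeffs (v0_even * (theta_neg oo fps_X ^ 4)) = fps_of_int_coeffs ((theta oo fps_X\<^sup>2)\<^sup>2)"
    using gm_even_prod by (simp only: gm_even_1 gm_even_0 gm_even_ii fps_of_int_coeffs_mult fps_of_int_coeffs_power)
  then show ?thesis by simp
qed

definition v0_quarter :: "int fps" where
  "v0_quarter = Abs_fps (\<lambda>n. 2 * v0 (4 * n) - (if n = 0 then 1 else 0))"

text \<open>Taking every fourth coefficient of \<open>v0_even_mult\<close> releases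
  \<open>theta_neg\<close> undilated. On the right it leaves every second coefficient of
  \<open>theta\<^sup>2\<close>, which is \<open>theta\<^sup>2\<close> again by
  \<open>theta_square_nth_double\<close>.\<close>

lemma v0_quarter_mult: "theta_neg * v0_quarter = theta\<^sup>2"
proof -
  have "v0_quarter = fps_section 4 v0_even"
    by (simp add: fps_eq_iff v0_quarter_def v0_even_def)
  then have "theta_neg * v0_quarter = fps_section 4 ((theta oo fps_X\<^sup>2)\<^sup>2)"
    using fps_section_compose_mult[of 4 theta_neg v0_even] v0_even_mult by (simp add: mult.commute)
  also have "\<dots> = fps_section 4 (theta\<^sup>2 oo fps_X\<^sup>2)"
    by (subst fps_compose_power) simp_all
  also have "\<dots> = theta\<^sup>2"
    using theta_square_nth_double by (auto simp: fps_eq_iff fps_nth_compose_X_power)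
  finally show ?thesis .
qed

section \<open>Quadrisection of theta series\<close>

abbreviation dil4 :: "int fps \<Rightarrow> int fps" where "dil4 f \<equiv> f oo fps_X ^ 4"

lemma dil4_mult: "dil4 (f * g) = dil4 f * dil4 g"
  by (rule fps_compose_mult_distrib) simp

lemma dil4_power: "dil4 (f ^ n) = dil4 f ^ n"
  by (rule fps_compose_power[symmetric]) simp

lemmas dil4_hom = fps_compose_add_distrib fps_compose_sub_distrib fps_compose_uminus dil4_mult dil4_power
  fps_compose_1 numeral_compose

lemma fps_X_power_mult_dil4_nth:
  assumes "j < 4" "i < 4"
  shows "(fps_X ^ j * dil4 f) $ (4 * m + i) = (if i = j then f $ m else 0)"
proof (cases "j \<le> 4 * m + i")
  case True
  have "4 dvd 4 * m + i - j \<longleftrightarrow> i = j"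
    using assms True by presburger
  then show ?thesis using True
    by (auto simp: fps_X_power_mult_nth fps_nth_compose_X_power)
next
  case False
  then have "i \<noteq> j" by simp
  then show ?thesis using False by (simp add: fps_X_power_mult_nth)
qed

lemma fps_numeral_mult_nth: "(numeral k * f) $ n = numeral k * (f $ n)" for f :: "'a::comm_ring_1 fps"
  by (simp add: numeral_fps_const)

lemma theta_nth_0: "theta $ 0 = 1" "theta_neg $ 0 = 1"
  using theta_nth_square[of 0] by (simp_all add: theta_neg_nth)

definition theta_inv :: "int fps" where
  "theta_inv = fps_right_inverse theta 1"

definition theta_neg_inv :: "int fps" where
  "theta_neg_inv = fps_right_inverse theta_neg 1"

lemma theta_inverses: "theta * theta_inv = 1" "theta_neg * theta_neg_inv = 1"
  unfolding theta_inv_def theta_neg_inv_def by (rule fps_right_inverse; simp add: theta_nth_0)+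

text \<open>This is the series usually written \<open>\<psi>(q^2)\<close>.\<close>

definition psi :: "int fps" where
  "psi = Abs_fps (\<lambda>n. if \<exists>k. 4 * n + 1 = k\<^sup>2 then 1 else 0)"

lemma square_mod_8: "(k::nat)\<^sup>2 mod 8 \<in> {0, 1, 4}"
proof -
  have "k mod 8 = 0 \<or> k mod 8 = 1 \<or> k mod 8 = 2 \<or> k mod 8 = 3 \<or> k mod 8 = 4 \<or> k mod 8 = 5 \<or> k mod 8 = 6 \<or> k mod 8 = 7"
    by linarith
  moreover have "k\<^sup>2 mod 8 = (k mod 8)\<^sup>2 mod 8" by (simp add: power_mod)
  ultimately show ?thesis by auto
qed

lemma psi_nth_odd: "odd m \<Longrightarrow> psi $ m = 0"
proof -
  assume "odd m"
  then have "(4 * m + 1) mod 8 = 5" by presburger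
  then have "4 * m + 1 \<noteq> k\<^sup>2" for k using square_mod_8[of k] by force
  then show ?thesis by (simp add: psi_def)
qed

text \<open>Squares are 0 or 1 modulo 4. Even roots reproduce \<open>theta\<close> at q^4; odd roots
  come in pairs k, -k, hence the factor 2. Passing to -q flips only the exponents that are 1 modulo
  4.\<close>

lemma theta_dissection: "theta = dil4 theta + 2 * (fps_X * dil4 psi)"
  "theta_neg = dil4 theta - 2 * (fps_X * dil4 psi)"
proof -
  have *: "theta $ (4 * m + i) = (dil4 theta + 2 * (fps_X * dil4 psi)) $ (4 * m + i) \<and>
     theta_neg $ (4 * m + i) = (dil4 theta - 2 * (fps_X * dil4 psi)) $ (4 * m + i)" if i: "i < 4" for m i
  proof -
    have 1: "dil4 theta $ (4 * m + i) = (if i = 0 then theta $ m else 0)"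
      using fps_X_power_mult_dil4_nth[of 0 i theta m] i by simp
    have 2: "(2 * (fps_X * dil4 psi)) $ (4 * m + i) = 2 * (if i = 1 then psi $ m else 0)"
      unfolding fps_numeral_mult_nth using fps_X_power_mult_dil4_nth[of 1 i psi m] i by simp
    consider "i = 0" | "i = 1" | "i = 2 \<or> i = 3" using i by linarith
    then have "theta $ (4 * m + i) = (if i = 0 then theta $ m else 0) + 2 * (if i = 1 then psi $ m else 0)"
    proof cases
      case 1
      have "theta $ (4 * m) = theta $ m"
      proof (cases "\<exists>k. m = k\<^sup>2")
        case True
        then obtain k where k: "m = k\<^sup>2" by blast
        then have "4 * m = (2 * k)\<^sup>2" by simp
        then show ?thesis unfolding k by (simp only: theta_nth_square) simp
      next
        case False
        have "4 * m \<noteq> k\<^sup>2" for k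
        proof
          assume eq: "4 * m = k\<^sup>2"
          then have "even (k\<^sup>2)" by (metis dvd_mult2 even_numeral)
          then obtain j where "k = 2 * j" by auto
          then have "m = j\<^sup>2" using eq by simp
          then show False using False by blast
        qed
        then show ?thesis using False by (simp add: theta_nth_nonsquare)
      qed
      then show ?thesis using 1 by simp
    next
      case 2
      show ?thesis
      proof (cases "\<exists>k. 4 * m + 1 = k\<^sup>2")
        case True
        then obtain k where k: "4 * m + 1 = k\<^sup>2" by blast
        then have "k \<noteq> 0" by (metis add_is_0 one_neq_zero zero_power2)
        then show ?thesis using 2 True theta_nth_square[of k] by (simp add: psi_def flip: k)
      next
        case False
        then show ?thesis using 2 theta_nth_nonsquare[of "4 * m + 1"] by (simp add: psi_def)
      qed
    next
      case 3
      then have "(4 * m + i) mod 4 \<in> {2, 3}" by auto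
      moreover have "k\<^sup>2 mod 4 \<notin> {2, 3}" for k :: nat
        using square_mod_8[of k] by (auto; presburger)
      ultimately have "\<nexists>k. 4 * m + i = k\<^sup>2" by metis
      then show ?thesis using 3 theta_nth_nonsquare by auto
    qed
    moreover have "(- 1 :: int) ^ (4 * m + i) = (- 1) ^ i" by (simp add: minus_one_power_iff)
    moreover have "(- 1) ^ i * ((if i = 0 then A else 0) + 2 * (if i = 1 then B else 0)) =
        (if i = 0 then A else 0) - 2 * (if i = 1 then B else 0)" for A B :: int
      by (cases "i = 0"; cases "i = 1")
         (simp_all only: simp_thms if_True if_False zero_neq_one one_neq_zero power_0 power_one_right, simp_all)
    ultimately show ?thesis
      unfolding fps_add_nth fps_sub_nth 1 2 theta_neg_nth by metis
  qed
  have "theta $ n = (dil4 theta + 2 * (fps_X * dil4 psi)) $ n \<and>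
     theta_neg $ n = (dil4 theta - 2 * (fps_X * dil4 psi)) $ n" for n
    by (rule *[of "n mod 4" "n div 4", unfolded mult_div_mod_eq]) (rule mod_less_divisor, rule zero_less_numeral)
  then show "theta = dil4 theta + 2 * (fps_X * dil4 psi)"
    "theta_neg = dil4 theta - 2 * (fps_X * dil4 psi)"
    by (rule fps_ext[OF conjunct1], rule fps_ext[OF conjunct2])
qed

text \<open>This is Jacobi's quartic identity at q^4. With \<open>theta\<close> = a + 2 b and
  \<open>theta_neg\<close> = a - 2 b, half the sum of their squares is a^2 + 4 b^2 and their product
  is a^2 - 4 b^2. Both are known at q^2, and multiplying them calls for
  \<open>theta_mult_theta_neg\<close> a second time.\<close>

lemma theta_quartic:
  "(dil4 theta) ^ 4 - 16 * (fps_X * dil4 psi) ^ 4 = dil4 (theta_neg ^ 4)"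
proof -
  define a b where "a = dil4 theta" and "b = fps_X * dil4 psi"
  have x: "theta = a + 2 * b" and y: "theta_neg = a - 2 * b"
    using theta_dissection by (simp_all only: a_def b_def)
  have "2 * (a\<^sup>2 + 4 * b\<^sup>2) = 2 * (theta\<^sup>2 oo fps_X\<^sup>2)"
    unfolding theta_square_add[symmetric] unfolding x y by algebra
  then have "a\<^sup>2 + 4 * b\<^sup>2 = theta\<^sup>2 oo fps_X\<^sup>2"
    by (rule mult_left_cancel[THEN iffD1, rotated]) simp
  moreover have "a\<^sup>2 - 4 * b\<^sup>2 = theta_neg\<^sup>2 oo fps_X\<^sup>2"
    unfolding theta_mult_theta_neg[symmetric] unfolding x y by algebra
  moreover have "a ^ 4 - 16 * b ^ 4 = (a\<^sup>2 + 4 * b\<^sup>2) * (a\<^sup>2 - 4 * b\<^sup>2)" by algebra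
  ultimately have "a ^ 4 - 16 * b ^ 4 = (theta\<^sup>2 oo fps_X\<^sup>2) * (theta_neg\<^sup>2 oo fps_X\<^sup>2)" by simp
  also have "\<dots> = (theta * theta_neg)\<^sup>2 oo fps_X\<^sup>2"
    by (subst fps_compose_mult_distrib[symmetric]) (simp_all add: power_mult_distrib)
  also have "\<dots> = (theta_neg\<^sup>2 oo fps_X\<^sup>2)\<^sup>2 oo fps_X\<^sup>2"
    by (simp only: theta_mult_theta_neg)
  also have "\<dots> = (theta_neg ^ 4 oo fps_X\<^sup>2) oo fps_X\<^sup>2"
    by (subst fps_compose_power) (simp_all flip: power_mult)
  also have "\<dots> = theta_neg ^ 4 oo (fps_X\<^sup>2 oo fps_X\<^sup>2)"
    by (rule fps_compose_assoc[symmetric]) simp_all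
  also have "fps_X\<^sup>2 oo fps_X\<^sup>2 = (fps_X ^ 4 :: int fps)"
    by (simp add: fps_X_power_compose flip: power_mult)
  finally show ?thesis by (simp only: a_def b_def)
qed

section \<open>Rational parametrization by beta, which is \<open>2 * half_beta\<close>\<close>

definition psi_ratio :: "int fps" where
  "psi_ratio = psi * theta_inv"

text \<open>This is \<open>\<beta>/2\<close>, which still has integer coefficients.\<close>

definition half_beta :: "int fps" where
  "half_beta = fps_X * dil4 psi_ratio"

definition theta_quot :: "int fps" where
  "theta_quot = (theta * theta_neg_inv) ^ 4"

definition theta_quot_inv :: "int fps" where
  "theta_quot_inv = (theta_neg * theta_inv) ^ 4"

text \<open>The definition is the explicit form of \<open>(s - 1)/16\<close>, see \<open>theta_quot_eq\<close>.\<close>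

definition theta_param :: "int fps" where
  "theta_param = fps_X * psi_ratio ^ 4 * theta_quot"

lemma theta_quot_inverse: "theta_quot * theta_quot_inv = 1"
proof -
  have "theta_quot * theta_quot_inv = ((theta * theta_inv) * (theta_neg * theta_neg_inv)) ^ 4"
    unfolding theta_quot_def theta_quot_inv_def power_mult_distrib by (simp only: mult_ac)
  then show ?thesis by (simp add: theta_inverses)
qed

lemma dil4_inject: "dil4 f = dil4 g \<Longrightarrow> f = g"
  by (metis fps_section_compose zero_less_numeral)

lemma dil4_inverses: "dil4 theta * dil4 theta_inv = 1" "dil4 theta_neg * dil4 theta_neg_inv = 1"
  unfolding dil4_mult[symmetric] theta_inverses by simp_all

lemma half_beta_mult: "dil4 theta * half_beta = fps_X * dil4 psi"
proof -
  have "dil4 theta * half_beta = fps_X * dil4 psi * (dil4 theta * dil4 theta_inv)"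
    unfolding half_beta_def psi_ratio_def dil4_mult by (simp only: mult_ac)
  then show ?thesis by (simp add: dil4_inverses)
qed

lemma theta_half_beta:
  "theta = dil4 theta * (1 + 2 * half_beta)" "theta_neg = dil4 theta * (1 - 2 * half_beta)"
proof -
  have "dil4 theta * (1 + 2 * half_beta) = dil4 theta + 2 * (dil4 theta * half_beta)"
    "dil4 theta * (1 - 2 * half_beta) = dil4 theta - 2 * (dil4 theta * half_beta)"
    by algebra+
  then show "theta = dil4 theta * (1 + 2 * half_beta)" "theta_neg = dil4 theta * (1 - 2 * half_beta)"
    unfolding half_beta_mult theta_dissection[symmetric] by simp_all
qed

text \<open>Jacobi's identity divided by the fourth power of \<open>theta_neg\<close> at
  q^4.\<close>

lemma half_beta_quot: "(1 - 16 * half_beta ^ 4) * dil4 theta_quot = 1"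
proof -
  have "(1 - 16 * half_beta ^ 4) * dil4 theta_quot =
      (dil4 theta ^ 4 - 16 * (dil4 theta * half_beta) ^ 4) * dil4 theta_neg_inv ^ 4"
    unfolding theta_quot_def dil4_power dil4_mult by algebra
  also have "\<dots> = (dil4 theta_neg * dil4 theta_neg_inv) ^ 4"
    unfolding half_beta_mult theta_quartic unfolding dil4_power power_mult_distrib ..
  finally show ?thesis by (simp add: dil4_inverses)
qed

text \<open>The algebraic relation for beta: its fourth power is already a series in q^4, namely 1 -
  1/s there. Higher powers of beta are reduced by it.\<close>

lemma half_beta_quot_inv: "16 * half_beta ^ 4 = dil4 (1 - theta_quot_inv)"
proof -
  have "dil4 theta_quot * dil4 theta_quot_inv = 1"
    unfolding dil4_mult[symmetric] theta_quot_inverse by simp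
  then have "1 - 16 * half_beta ^ 4 = (1 - 16 * half_beta ^ 4) * dil4 theta_quot * dil4 theta_quot_inv"
    by (simp only: mult.assoc mult_1_right)
  also have "\<dots> = dil4 theta_quot_inv"
    by (simp only: half_beta_quot mult_1_left)
  finally have "dil4 (1 - theta_quot_inv) = 1 - (1 - 16 * half_beta ^ 4)"
    by (simp only: dil4_hom)
  then show ?thesis by (simp only: diff_diff_eq2 add_diff_cancel_left')
qed

lemma half_beta_power: "half_beta ^ j = fps_X ^ j * dil4 (psi_ratio ^ j)"
  unfolding half_beta_def power_mult_distrib dil4_power ..

lemma dil4_X: "dil4 fps_X = fps_X ^ 4"
  by simp

text \<open>Since \<open>half_beta ^ 4\<close> is q^4 times the dilated
  \<open>psi_ratio ^ 4\<close>, the claim at q^4 is a rearranged \<open>half_beta_quot\<close>, and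
  dilation is injective.\<close>

lemma theta_quot_eq: "theta_quot = 1 + 16 * theta_param"
proof (rule dil4_inject)
  have "dil4 (1 + 16 * theta_param) = 1 + 16 * half_beta ^ 4 * dil4 theta_quot"
    unfolding half_beta_power theta_param_def dil4_hom dil4_X by (simp only: mult.assoc)
  also have "\<dots> = dil4 theta_quot"
    using half_beta_quot unfolding left_diff_distrib mult_1_left by (simp only: diff_eq_eq)
  finally show "dil4 theta_quot = dil4 (1 + 16 * theta_param)" by simp
qed

lemma theta_quot_minus_1: "theta_quot - 1 = 16 * theta_param"
  by (subst theta_quot_eq) simp

text \<open>As 1 - beta^4 = (1 - beta) (1 + beta) (1 + beta^2) has inverse s(q^4), both 1 / (1 -
  beta) and 1 / (1 + beta) are polynomials in beta times s(q^4).\<close>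

lemma theta_ratios:
  "dil4 theta * theta_neg_inv = (1 + 2 * half_beta) * (1 + 4 * half_beta\<^sup>2) * dil4 theta_quot"
  "dil4 theta * theta_inv = (1 - 2 * half_beta) * (1 + 4 * half_beta\<^sup>2) * dil4 theta_quot"
proof -
  define a h S where "a = dil4 theta" and "h = half_beta" and "S = dil4 theta_quot"
  have S: "(1 - 16 * h ^ 4) * S = 1" using half_beta_quot by (simp only: h_def S_def)
  have x: "a * (1 + 2 * h) * theta_inv = 1" "a * (1 - 2 * h) * theta_neg_inv = 1"
    using theta_inverses by (simp_all only: theta_half_beta[symmetric] a_def h_def)
  have "a * theta_neg_inv * ((1 - 16 * h ^ 4) * S) =
      (1 + 2 * h) * (1 + 4 * h\<^sup>2) * S * (a * (1 - 2 * h) * theta_neg_inv)"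
    by algebra
  moreover have "a * theta_inv * ((1 - 16 * h ^ 4) * S) =
      (1 - 2 * h) * (1 + 4 * h\<^sup>2) * S * (a * (1 + 2 * h) * theta_inv)"
    by algebra
  ultimately show "dil4 theta * theta_neg_inv = (1 + 2 * half_beta) * (1 + 4 * half_beta\<^sup>2) * dil4 theta_quot"
    "dil4 theta * theta_inv = (1 - 2 * half_beta) * (1 + 4 * half_beta\<^sup>2) * dil4 theta_quot"
    unfolding x S mult_1_right by (simp_all only: a_def h_def S_def)
qed

lemma theta_quot_half_beta:
  "theta_quot = ((1 + 2 * half_beta)\<^sup>2 * (1 + 4 * half_beta\<^sup>2) * dil4 theta_quot) ^ 4"
proof -
  have "theta * theta_neg_inv = (1 + 2 * half_beta) * (dil4 theta * theta_neg_inv)"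
    by (subst theta_half_beta(1)) (simp only: mult_ac)
  then show ?thesis
    unfolding theta_ratios theta_quot_def[symmetric] unfolding power2_eq_square
    by (subst theta_quot_def) (simp only: mult_ac)
qed

lemma theta_quot_inv_half_beta:
  "theta_quot_inv = ((1 - 2 * half_beta)\<^sup>2 * (1 + 4 * half_beta\<^sup>2) * dil4 theta_quot) ^ 4"
proof -
  have "theta_neg * theta_inv = (1 - 2 * half_beta) * (dil4 theta * theta_inv)"
    by (subst theta_half_beta(2)) (simp only: mult_ac)
  then show ?thesis
    unfolding theta_ratios unfolding power2_eq_square
    by (subst theta_quot_inv_def) (simp only: mult_ac)
qed

lemma theta_param_half_beta:
  "theta_param = half_beta * (1 + 2 * half_beta) ^ 4 * (1 + 4 * half_beta\<^sup>2) ^ 5 * dil4 theta_quot ^ 4"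
proof -
  define h S g where "h = half_beta" and "S = dil4 theta_quot" and "g = (1 + 2 * h) * (1 + 4 * h\<^sup>2) * S"
  have g: "(1 - 2 * h) * g = 1"
  proof -
    have "(1 - 2 * h) * g = (1 - 16 * h ^ 4) * S" unfolding g_def by algebra
    then show ?thesis using half_beta_quot by (simp only: h_def S_def)
  qed
  have "16 * theta_param = theta_quot - 1" by (rule theta_quot_minus_1[symmetric])
  also have "theta_quot = ((1 + 2 * h) * g) ^ 4"
    unfolding g_def h_def S_def by (subst theta_quot_half_beta) (simp only: power2_eq_square mult_ac)
  \<comment> \<open>As (1 - 2 h) g = 1, the subtracted 1 becomes a fourth power too, and (1 + 2 h)^4
    - (1 - 2 h)^4 = 16 h (1 + 4 h^2).\<close>
  also have "((1 + 2 * h) * g) ^ 4 - 1 = ((1 + 2 * h) * g) ^ 4 - ((1 - 2 * h) * g) ^ 4"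
    unfolding g by simp
  also have "\<dots> = 16 * (h * (1 + 4 * h\<^sup>2) * g ^ 4)" by algebra
  also have "h * (1 + 4 * h\<^sup>2) * g ^ 4 = h * (1 + 2 * h) ^ 4 * (1 + 4 * h\<^sup>2) ^ 5 * S ^ 4"
    unfolding g_def by algebra
  finally show ?thesis
    unfolding h_def S_def by (rule mult_left_cancel[THEN iffD1, rotated]) simp
qed

lemma v0_quarter_half_beta:
  "v0_quarter = dil4 theta * ((1 + 2 * half_beta) ^ 3 * (1 + 4 * half_beta\<^sup>2) * dil4 theta_quot)"
proof -
  have "v0_quarter = theta_neg * theta_neg_inv * v0_quarter" by (simp add: theta_inverses)
  also have "\<dots> = theta_neg_inv * (theta_neg * v0_quarter)" by (simp only: mult_ac)
  also have "\<dots> = theta_neg_inv * theta\<^sup>2" by (simp only: v0_quarter_mult)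
  also have "\<dots> = theta_neg_inv * (dil4 theta * (1 + 2 * half_beta))\<^sup>2"
    by (subst theta_half_beta(1)) (rule refl)
  also have "\<dots> = dil4 theta * (1 + 2 * half_beta)\<^sup>2 * (dil4 theta * theta_neg_inv)"
    by algebra
  also have "\<dots> = dil4 theta * ((1 + 2 * half_beta) ^ 3 * (1 + 4 * half_beta\<^sup>2) * dil4 theta_quot)"
    unfolding theta_ratios by algebra
  finally show ?thesis .
qed

section \<open>The operator U on theta quotients\<close>

inductive_set quot_ring :: "int fps set" where
  quot: "theta_quot \<in> quot_ring"
| quot_inv: "theta_quot_inv \<in> quot_ring"
| one: "1 \<in> quot_ring"
| minus: "f \<in> quot_ring \<Longrightarrow> g \<in> quot_ring \<Longrightarrow> f - g \<in> quot_ring"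
| mult: "f \<in> quot_ring \<Longrightarrow> g \<in> quot_ring \<Longrightarrow> f * g \<in> quot_ring"

lemma quot_ring_zero: "0 \<in> quot_ring"
  using quot_ring.minus[OF quot_ring.one quot_ring.one] by simp

lemma quot_ring_add: "f \<in> quot_ring \<Longrightarrow> g \<in> quot_ring \<Longrightarrow> f + g \<in> quot_ring"
  using quot_ring.minus[of f "0 - g"] quot_ring.minus[OF quot_ring_zero, of g] by simp

text \<open>Polynomials in beta over the dilated \<open>quot_ring\<close>. Degree 3 is enough
  because beta^4 is a dilated ring element, and the four parts occupy distinct residues of exponents
  modulo 4, which a section separates.\<close>

definition beta_ring :: "int fps set" where
  "beta_ring = {dil4 f0 + 2 * half_beta * dil4 f1 + (2 * half_beta)\<^sup>2 * dil4 f2 + (2 * half_beta) ^ 3 * dil4 f3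
     | f0 f1 f2 f3. f0 \<in> quot_ring \<and> f1 \<in> quot_ring \<and> f2 \<in> quot_ring \<and> f3 \<in> quot_ring}"

lemma beta_ringI:
  assumes "f0 \<in> quot_ring" "f1 \<in> quot_ring" "f2 \<in> quot_ring" "f3 \<in> quot_ring"
    and "f = dil4 f0 + 2 * half_beta * dil4 f1 + (2 * half_beta)\<^sup>2 * dil4 f2 + (2 * half_beta) ^ 3 * dil4 f3"
  shows "f \<in> beta_ring"
  using assms unfolding beta_ring_def by blast

lemma beta_ring_dil4: "f \<in> quot_ring \<Longrightarrow> dil4 f \<in> beta_ring"
  by (rule beta_ringI[of f 0 0 0]) (simp_all add: quot_ring_zero)

lemma beta_ring_beta: "2 * half_beta \<in> beta_ring"
  by (rule beta_ringI[of 0 1 0 0]) (simp_all add: quot_ring_zero quot_ring.one)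

lemma beta_ring_one: "1 \<in> beta_ring"
  using beta_ring_dil4[OF quot_ring.one] by simp

lemma beta_ring_minus:
  assumes "f \<in> beta_ring" "g \<in> beta_ring"
  shows "f - g \<in> beta_ring"
proof -
  from assms(1) obtain f0 f1 f2 f3 where f: "f0 \<in> quot_ring" "f1 \<in> quot_ring" "f2 \<in> quot_ring" "f3 \<in> quot_ring"
    "f = dil4 f0 + 2 * half_beta * dil4 f1 + (2 * half_beta)\<^sup>2 * dil4 f2 + (2 * half_beta) ^ 3 * dil4 f3"
    unfolding beta_ring_def by blast
  from assms(2) obtain g0 g1 g2 g3 where g: "g0 \<in> quot_ring" "g1 \<in> quot_ring" "g2 \<in> quot_ring" "g3 \<in> quot_ring"
    "g = dil4 g0 + 2 * half_beta * dil4 g1 + (2 * half_beta)\<^sup>2 * dil4 g2 + (2 * half_beta) ^ 3 * dil4 g3"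
    unfolding beta_ring_def by blast
  show ?thesis
    by (rule beta_ringI[of "f0 - g0" "f1 - g1" "f2 - g2" "f3 - g3"])
       (use f g in \<open>simp_all only: quot_ring.minus dil4_hom right_diff_distrib add_diff_add\<close>)
qed

lemma beta_ring_mult:
  assumes "f \<in> beta_ring" "g \<in> beta_ring"
  shows "f * g \<in> beta_ring"
proof -
  from assms(1) obtain f0 f1 f2 f3 where f: "f0 \<in> quot_ring" "f1 \<in> quot_ring" "f2 \<in> quot_ring" "f3 \<in> quot_ring"
    "f = dil4 f0 + 2 * half_beta * dil4 f1 + (2 * half_beta)\<^sup>2 * dil4 f2 + (2 * half_beta) ^ 3 * dil4 f3"
    unfolding beta_ring_def by blast
  from assms(2) obtain g0 g1 g2 g3 where g: "g0 \<in> quot_ring" "g1 \<in> quot_ring" "g2 \<in> quot_ring" "g3 \<in> quot_ring"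
    "g = dil4 g0 + 2 * half_beta * dil4 g1 + (2 * half_beta)\<^sup>2 * dil4 g2 + (2 * half_beta) ^ 3 * dil4 g3"
    unfolding beta_ring_def by blast
  \<comment> \<open>This is beta^4 before dilation; it folds the degrees 4 to 6 of the product back
    below 4.\<close>
  define e where "e = 1 - theta_quot_inv"
  have e: "e \<in> quot_ring" unfolding e_def by (intro quot_ring.intros)
  have beta4: "(2 * half_beta) ^ 4 = dil4 e"
    using half_beta_quot_inv by (simp add: power_mult_distrib e_def)
  have reduce: "(F0 + b * F1 + b\<^sup>2 * F2 + b ^ 3 * F3) * (G0 + b * G1 + b\<^sup>2 * G2 + b ^ 3 * G3) =
      (F0 * G0 + E * (F1 * G3 + F2 * G2 + F3 * G1)) + b * (F0 * G1 + F1 * G0 + E * (F2 * G3 + F3 * G2))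
      + b\<^sup>2 * (F0 * G2 + F1 * G1 + F2 * G0 + E * (F3 * G3)) + b ^ 3 * (F0 * G3 + F1 * G2 + F2 * G1 + F3 * G0)"
    if "b ^ 4 = E" for b E F0 F1 F2 F3 G0 G1 G2 G3 :: "int fps"
    unfolding that[symmetric] by algebra
  show ?thesis
    unfolding f(5) g(5) reduce[OF beta4]
    by (rule beta_ringI[of "f0 * g0 + e * (f1 * g3 + f2 * g2 + f3 * g1)" "f0 * g1 + f1 * g0 + e * (f2 * g3 + f3 * g2)"
          "f0 * g2 + f1 * g1 + f2 * g0 + e * (f3 * g3)" "f0 * g3 + f1 * g2 + f2 * g1 + f3 * g0"])
       (intro quot_ring_add quot_ring.mult e f g | simp only: dil4_hom)+
qed

lemma beta_ring_add: "f \<in> beta_ring \<Longrightarrow> g \<in> beta_ring \<Longrightarrow> f + g \<in> beta_ring"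
  using beta_ring_minus[of f "0 - g"] beta_ring_minus[of 0 g] beta_ring_minus[OF beta_ring_one beta_ring_one] by simp

lemma beta_ring_power: "f \<in> beta_ring \<Longrightarrow> f ^ n \<in> beta_ring"
  by (induction n) (simp_all add: beta_ring_one beta_ring_mult)

lemma beta_ring_four: "4 * half_beta\<^sup>2 \<in> beta_ring"
  using beta_ring_power[OF beta_ring_beta, of 2] by (simp add: power_mult_distrib)

text \<open>Only the generators matter: s and 1/s are fourth powers of polynomials in beta times
  s(q^4).\<close>

lemma quot_ring_subset_beta_ring: "f \<in> quot_ring \<Longrightarrow> f \<in> beta_ring"
proof (induction rule: quot_ring.induct)
  case quot
  show ?case by (subst theta_quot_half_beta)
    (intro beta_ring_power beta_ring_mult beta_ring_add beta_ring_one beta_ring_beta beta_ring_four beta_ring_dil4 quot_ring.quot)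
next
  case quot_inv
  show ?case by (subst theta_quot_inv_half_beta)
    (intro beta_ring_power beta_ring_mult beta_ring_add beta_ring_minus beta_ring_one beta_ring_beta beta_ring_four beta_ring_dil4 quot_ring.quot)
qed (auto intro: beta_ring_one beta_ring_minus beta_ring_mult)

lemma fps_section_X_power_dil4:
  assumes "j < 4"
  shows "fps_section 4 (fps_X ^ j * dil4 f) = (if j = 0 then f else 0)"
  using fps_X_power_mult_dil4_nth[OF assms, of 0 f] by (simp add: fps_eq_iff)

lemma fps_section_half_beta:
  "fps_section 4 (dil4 f0 + half_beta * dil4 f1 + half_beta\<^sup>2 * dil4 f2 + half_beta ^ 3 * dil4 f3) = f0"
proof -
  have "half_beta ^ j * dil4 f = fps_X ^ j * dil4 (psi_ratio ^ j * f)" for j f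
    unfolding half_beta_power dil4_mult by (simp only: mult.assoc)
  then have "fps_section 4 (half_beta ^ j * dil4 f) = (if j = 0 then f else 0)" if "j < 4" for j f
    using that by (simp add: fps_section_X_power_dil4)
  from this[of 0 f0] this[of 1 f1] this[of 2 f2] this[of 3 f3] show ?thesis
    by (simp add: fps_section_add)
qed

lemma theta_quot_minus_1_mult: "(theta_quot - 1) * theta_quot_inv = 1 - theta_quot_inv"
  using theta_quot_inverse by (simp add: left_diff_distrib)

text \<open>The prefactor beta raises every part by one degree, so only the cubic part reaches
  residue 0, as beta^4 = 1 - 1/s = (s - 1)/s. Thus the factor s - 1 reappears after the
  section.\<close>

lemma fps_section_beta_ring:
  assumes "f \<in> beta_ring"
  shows "\<exists>r\<in>quot_ring. fps_section 4 (dil4 theta * (2 * half_beta) * f) = theta * (theta_quot - 1) * r"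
proof -
  from assms obtain f0 f1 f2 f3 where f: "f3 \<in> quot_ring"
    "f = dil4 f0 + 2 * half_beta * dil4 f1 + (2 * half_beta)\<^sup>2 * dil4 f2 + (2 * half_beta) ^ 3 * dil4 f3"
    unfolding beta_ring_def by blast
  have "dil4 theta * (2 * half_beta) * f = dil4 theta * (16 * half_beta ^ 4) * dil4 f3
     + half_beta * (dil4 theta * 2 * dil4 f0) + half_beta\<^sup>2 * (dil4 theta * 4 * dil4 f1) + half_beta ^ 3 * (dil4 theta * 8 * dil4 f2)"
    unfolding f(2) by algebra
  also have "\<dots> = dil4 (theta * (1 - theta_quot_inv) * f3) + half_beta * dil4 (theta * 2 * f0)
      + half_beta\<^sup>2 * dil4 (theta * 4 * f1) + half_beta ^ 3 * dil4 (theta * 8 * f2)"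
    unfolding half_beta_quot_inv dil4_mult numeral_compose ..
  finally have "fps_section 4 (dil4 theta * (2 * half_beta) * f) = theta * (theta_quot - 1) * (theta_quot_inv * f3)"
    unfolding fps_section_half_beta theta_quot_minus_1_mult[symmetric]
    by (simp only: fps_section_half_beta mult.assoc)
  then show ?thesis using f(1) by (blast intro: quot_ring.intros)
qed

lemma fps_section_numeral_mult:
  "fps_section k (numeral c * f) = numeral c * fps_section k (f :: 'a::comm_ring_1 fps)"
  by (simp add: fps_eq_iff fps_numeral_mult_nth)

text \<open>The gain is 8 because s - 1 is \<open>16 * half_beta\<close>, that is 8 beta, times an
  element of \<open>beta_ring\<close>. In \<open>f\<close> the fifth power of 1 + beta includes the
  factor that comes from \<open>theta\<close> itself.\<close>

lemma fps_section_quot_ring: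
  assumes "r \<in> quot_ring"
  shows "\<exists>r'\<in>quot_ring. fps_section 4 (theta * (theta_quot - 1) * r) = 8 * (theta * (theta_quot - 1) * r')"
proof -
  define f where "f = (1 + 2 * half_beta) ^ 5 * (1 + 4 * half_beta\<^sup>2) ^ 5 * dil4 theta_quot ^ 4 * r"
  have "f \<in> beta_ring"
    unfolding f_def
    by (intro beta_ring_power beta_ring_mult beta_ring_add beta_ring_one beta_ring_beta beta_ring_four
        beta_ring_dil4 quot_ring.quot quot_ring_subset_beta_ring assms)
  then obtain r' where r': "r' \<in> quot_ring"
    "fps_section 4 (dil4 theta * (2 * half_beta) * f) = theta * (theta_quot - 1) * r'"
    using fps_section_beta_ring by blast
  have "theta_quot - 1 = 16 * (half_beta * (1 + 2 * half_beta) ^ 4 * (1 + 4 * half_beta\<^sup>2) ^ 5 * dil4 theta_quot ^ 4)"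
    unfolding theta_param_half_beta[symmetric] by (rule theta_quot_minus_1)
  then have "theta * (theta_quot - 1) * r = dil4 theta * (1 + 2 * half_beta) *
     (16 * (half_beta * (1 + 2 * half_beta) ^ 4 * (1 + 4 * half_beta\<^sup>2) ^ 5 * dil4 theta_quot ^ 4)) * r"
    by (simp only: theta_half_beta(1)[symmetric])
  also have "\<dots> = 8 * (dil4 theta * (2 * half_beta) * f)"
    unfolding f_def by algebra
  finally show ?thesis using r' by (metis fps_section_numeral_mult)
qed

lemma fps_section_v0_quarter: "fps_section 4 v0_quarter = theta + 4 * (theta * (theta_quot - 1))"
proof -
  define a h S where "a = dil4 theta" and "h = half_beta" and "S = dil4 theta_quot"
  \<comment> \<open>Here (1 + beta)^3 (1 + beta^2) = 1 + 3 beta + 4 beta^2 + 4 beta^3 + 3 beta^4 +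
    beta^5; the section keeps only the constant and the quartic part.\<close>
  have "v0_quarter = a * S + 3 * (a * (16 * h ^ 4) * S) + h * (6 * a * S + 2 * (a * (16 * h ^ 4) * S))
      + h\<^sup>2 * (16 * a * S) + h ^ 3 * (32 * a * S)"
    unfolding v0_quarter_half_beta a_def h_def S_def by algebra
  also have "\<dots> = dil4 (theta * theta_quot + 3 * (theta * (1 - theta_quot_inv) * theta_quot))
     + h * dil4 (6 * theta * theta_quot + 2 * (theta * (1 - theta_quot_inv) * theta_quot))
     + h\<^sup>2 * dil4 (16 * theta * theta_quot) + h ^ 3 * dil4 (32 * theta * theta_quot)"
    unfolding h_def a_def S_def half_beta_quot_inv dil4_mult numeral_compose fps_compose_add_distrib ..
  finally have "fps_section 4 v0_quarter = theta * theta_quot + 3 * (theta * (1 - theta_quot_inv) * theta_quot)"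
    unfolding h_def by (rule subst[OF sym]) (rule fps_section_half_beta)
  also have "\<dots> = theta + 4 * (theta * (theta_quot - 1))"
    using theta_quot_inverse by algebra
  finally show ?thesis .
qed

text \<open>Both s and 1/s are 1 modulo 16. This later lets an unspecified ring element be treated
  as an integer.\<close>

lemma quot_ring_mod_16:
  assumes "r \<in> quot_ring"
  shows "\<exists>c g. r = fps_const c + 16 * g"
  using assms
proof (induction rule: quot_ring.induct)
  case quot
  show ?case using theta_quot_eq by (metis fps_const_1_eq_1)
next
  case quot_inv
  have "theta_quot_inv = (1 + 16 * theta_param) * theta_quot_inv + 16 * (- (theta_param * theta_quot_inv))"
    by algebra
  then have "theta_quot_inv = fps_const 1 + 16 * (- (theta_param * theta_quot_inv))"
    unfolding theta_quot_eq[symmetric] theta_quot_inverse fps_const_1_eq_1 .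
  then show ?case by blast
next
  case one
  have "1 = fps_const 1 + 16 * (0 :: int fps)" by simp
  then show ?case by blast
next
  case (minus f g)
  then obtain c d u v where "f = fps_const c + 16 * u" "g = fps_const d + 16 * v" by blast
  then have "f - g = fps_const (c - d) + 16 * (u - v)"
    unfolding fps_const_sub[symmetric] by algebra
  then show ?case by blast
next
  case (mult f g)
  then obtain c d u v where "f = fps_const c + 16 * u" "g = fps_const d + 16 * v" by blast
  then have "f * g = fps_const (c * d) + 16 * (fps_const c * v + fps_const d * u + 16 * u * v)"
    unfolding fps_const_mult[symmetric] by algebra
  then show ?case by blast
qed

section \<open>Iterating the section from \<open>v0_quarter\<close>\<close>

lemma fps_section_theta: "fps_section 4 theta = theta"
proof -
  have "theta = dil4 theta + half_beta * dil4 (2 * theta)"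
    by (subst theta_half_beta(1)) (simp only: dil4_hom, algebra)
  from arg_cong[OF this, of "fps_section 4"] show ?thesis
    using fps_section_half_beta[of theta "2 * theta" 0 0] by (simp only: fps_compose_0 mult_zero_right add_0_right)
qed

lemma fps_section_numeral_power_mult:
  "fps_section k (numeral c ^ a * f) = numeral c ^ a * fps_section k (f :: 'a::comm_ring_1 fps)"
  by (induction a) (simp_all only: power_0 power_Suc mult_1_left mult.assoc fps_section_numeral_mult)

text \<open>The section fixes \<open>theta\<close> and each further step brings a factor 8. The
  first step yields only the 4, hence \<open>8 ^ \<alpha>\<close> after \<open>Suc \<alpha>\<close>
  steps.\<close>

lemma fps_section_iterate_v0_quarter:
  "\<exists>r\<in>quot_ring. (fps_section 4 ^^ Suc \<alpha>) v0_quarter = theta + 4 * (8 ^ \<alpha> * (theta * (theta_quot - 1) * r))"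
proof (induction \<alpha>)
  case 0
  show ?case
    by (rule bexI[OF _ quot_ring.one])
      (simp only: funpow.simps o_apply id_apply fps_section_v0_quarter power_0 mult_1_left mult_1_right)
next
  case (Suc \<alpha>)
  then obtain r where r: "r \<in> quot_ring"
    "(fps_section 4 ^^ Suc \<alpha>) v0_quarter = theta + 4 * (8 ^ \<alpha> * (theta * (theta_quot - 1) * r))" by blast
  from fps_section_quot_ring[OF r(1)] obtain r' where r': "r' \<in> quot_ring"
    "fps_section 4 (theta * (theta_quot - 1) * r) = 8 * (theta * (theta_quot - 1) * r')" by blast
  have "(fps_section 4 ^^ Suc (Suc \<alpha>)) v0_quarter = fps_section 4 ((fps_section 4 ^^ Suc \<alpha>) v0_quarter)"
    by (simp only: funpow.simps o_apply)
  also have "\<dots> = theta + 4 * (8 ^ Suc \<alpha> * (theta * (theta_quot - 1) * r'))"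
    unfolding r(2) by (simp only: fps_section_add fps_section_theta fps_section_numeral_mult
        fps_section_numeral_power_mult r'(2)) (simp only: power_Suc2 mult.assoc)
  finally show ?case using r'(1) by blast
qed

lemma fps_section_iterate_nth: "(fps_section 4 ^^ \<alpha>) f $ n = f $ (4 ^ \<alpha> * n)"
  by (induction \<alpha> arbitrary: n) (simp_all add: mult_ac)

section \<open>Coefficients in residue classes\<close>

lemma one_plus_16_mult_power: "\<exists>k. (1 + 16 * g) ^ n = 1 + 16 * (k :: 'a::comm_ring_1)"
proof (induction n)
  case (Suc n)
  then obtain k where "(1 + 16 * g) ^ n = 1 + 16 * k" by blast
  then have "(1 + 16 * g) ^ Suc n = 1 + 16 * (g + k + 16 * g * k)"
    by (simp add: algebra_simps)
  then show ?case by blast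
qed (simp add: exI[of _ 0])

lemma half_beta_monomial:
  "dil4 theta * half_beta * half_beta ^ j = fps_X ^ Suc j * dil4 (psi * psi_ratio ^ j)"
  unfolding half_beta_mult unfolding half_beta_power dil4_mult power_Suc by (simp only: mult_ac)

text \<open>Modulo 16 the factor s(q^4)^4 is 1 and the expansion in \<open>half_beta\<close> breaks
  off; the four surviving monomials have distinct exponents modulo 4.\<close>

lemma theta_param_mod_16:
  "\<exists>k. theta * theta_param = fps_X ^ 1 * dil4 psi + 10 * (fps_X\<^sup>2 * dil4 (psi * psi_ratio))
     + 60 * (fps_X ^ 3 * dil4 (psi * psi_ratio\<^sup>2)) + 280 * (fps_X ^ 0 * dil4 (fps_X * (psi * psi_ratio ^ 3))) + 16 * k"
proof -
  define b h where "b = dil4 theta * half_beta" and "h = half_beta"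
  obtain k where k: "(1 + 16 * dil4 theta_param) ^ 4 = 1 + 16 * k"
    using one_plus_16_mult_power by blast
  have S: "dil4 theta_quot = 1 + 16 * dil4 theta_param"
    by (subst theta_quot_eq) (simp only: dil4_hom)
  define p where "p = (1 + 2 * h) ^ 5 * (1 + 4 * h\<^sup>2) ^ 5"
  \<comment> \<open>The part of \<open>p\<close> from degree 4 on, divided by 16: the coefficient of
    h^j in \<open>p\<close> is divisible by 2^j.\<close>
  define l where "l = h ^ 4 * (65 + 202 * h + 540 * h ^ 2 + 1240 * h ^ 3 + 2480 * h ^ 4 + 4320 * h ^ 5
    + 6464 * h ^ 6 + 8320 * h ^ 7 + 8960 * h ^ 8 + 7680 * h ^ 9 + 5120 * h ^ 10 + 2048 * h ^ 11)"
  have p: "p = 1 + 10 * h + 60 * h\<^sup>2 + 280 * h ^ 3 + 16 * l"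
    unfolding p_def l_def by algebra
  have "theta * theta_param = dil4 theta * (1 + 2 * h) * (h * (1 + 2 * h) ^ 4 * (1 + 4 * h\<^sup>2) ^ 5 * dil4 theta_quot ^ 4)"
    unfolding h_def theta_param_half_beta[symmetric] theta_half_beta(1)[symmetric] ..
  also have "\<dots> = (dil4 theta * h) * p * dil4 theta_quot ^ 4"
    unfolding p_def by algebra
  also have "\<dots> = b * p * (1 + 16 * k)"
    unfolding S k b_def h_def ..
  also have "\<dots> = b * h ^ 0 + 10 * (b * h ^ 1) + 60 * (b * h\<^sup>2) + 280 * (b * h ^ 3) + 16 * (b * l + b * p * k)"
    unfolding p by algebra
  also have "\<dots> = fps_X ^ 1 * dil4 psi + 10 * (fps_X\<^sup>2 * dil4 (psi * psi_ratio))
     + 60 * (fps_X ^ 3 * dil4 (psi * psi_ratio\<^sup>2)) + 280 * (fps_X ^ 4 * dil4 (psi * psi_ratio ^ 3)) + 16 * (b * l + b * p * k)"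
    unfolding b_def h_def half_beta_monomial
    by (simp only: power_0 power_one_right mult_1_right Suc_eq_plus1 add_0_left one_add_one numeral_plus_one Num.add_num_simps)
  also have "fps_X ^ 4 * dil4 (psi * psi_ratio ^ 3) = fps_X ^ 0 * dil4 (fps_X * (psi * psi_ratio ^ 3))"
    by (simp only: dil4_mult dil4_X power_0 mult_1_left)
  finally show ?thesis by blast
qed

text \<open>All coefficients of \<open>theta\<close> except the constant 1 are even, so its square
  is 1 modulo 4.\<close>

lemma theta_inv_square_mod_4: "\<exists>g. theta_inv\<^sup>2 = 1 + 4 * g"
proof -
  define v where "v = Abs_fps (\<lambda>n. if n = 0 then 0 else theta $ n div 2)"
  have v: "theta = 1 + 2 * v"
  proof (rule fps_ext)
    fix n
    have "even (theta $ n)" if "n \<noteq> 0"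
    proof (cases "\<exists>k. n = k\<^sup>2")
      case True
      then obtain k where "n = k\<^sup>2" by blast
      then show ?thesis using that by (simp add: theta_nth_square)
    qed (simp add: theta_nth_nonsquare)
    then have "theta $ n = (if n = 0 then 1 else 0) + 2 * v $ n"
      by (cases "n = 0") (simp_all add: v_def theta_nth_0)
    then show "theta $ n = (1 + 2 * v) $ n"
      by (simp only: fps_add_nth fps_numeral_mult_nth fps_one_nth)
  qed
  have "theta_inv\<^sup>2 = (theta * theta_inv)\<^sup>2 + 4 * (- (v + v\<^sup>2) * theta_inv\<^sup>2)"
    by (subst v) algebra
  then show ?thesis unfolding theta_inverses power_one by blast
qed

text \<open>The series is psi^3 / theta^2, which agrees with psi^3 modulo 4, and \<open>psi\<close>
  is a series in q^2.\<close>

lemma psi_ratio_nth_odd: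
  assumes "odd m"
  shows "4 dvd (psi * psi_ratio\<^sup>2) $ m"
proof -
  obtain g where g: "theta_inv\<^sup>2 = 1 + 4 * g" using theta_inv_square_mod_4 by blast
  have psi: "psi = fps_section 2 psi oo fps_X\<^sup>2"
    by (rule fps_ext) (auto simp: fps_nth_compose_X_power psi_nth_odd)
  have "psi ^ 3 = fps_section 2 psi ^ 3 oo fps_X\<^sup>2"
    by (subst psi) (rule fps_compose_power, simp)
  then have "psi ^ 3 $ m = 0" using assms by (simp add: fps_nth_compose_X_power)
  moreover have "psi * psi_ratio\<^sup>2 = psi ^ 3 + 4 * (psi ^ 3 * g)"
  proof -
    have "psi * psi_ratio\<^sup>2 = psi ^ 3 * theta_inv\<^sup>2" unfolding psi_ratio_def by algebra
    then show ?thesis unfolding g by (simp only: distrib_left mult_1_right mult_1_left mult_ac)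
  qed
  ultimately show ?thesis by (simp only: fps_add_nth fps_numeral_mult_nth) simp
qed

text \<open>Residues 2 and 3 carry the coefficients 10 and 60. For odd m, \<open>psi\<close>
  vanishes at m, which clears residue 1, and in residue 3 the 60 meets another 4 from
  \<open>psi_ratio_nth_odd\<close>.\<close>

lemma theta_param_nth:
  "2 dvd (theta * theta_param) $ (4 * m + 2)"
  "4 dvd (theta * theta_param) $ (4 * m + 3)"
  "odd m \<Longrightarrow> 16 dvd (theta * theta_param) $ (4 * m + 1)"
  "odd m \<Longrightarrow> 16 dvd (theta * theta_param) $ (4 * m + 3)"
proof -
  obtain k where k: "theta * theta_param = fps_X ^ 1 * dil4 psi + 10 * (fps_X\<^sup>2 * dil4 (psi * psi_ratio))
     + 60 * (fps_X ^ 3 * dil4 (psi * psi_ratio\<^sup>2)) + 280 * (fps_X ^ 0 * dil4 (fps_X * (psi * psi_ratio ^ 3))) + 16 * k"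
    using theta_param_mod_16 by blast
  have nth: "(theta * theta_param) $ (4 * m + i) = (if i = 1 then psi $ m else 0)
    + 10 * (if i = 2 then (psi * psi_ratio) $ m else 0) + 60 * (if i = 3 then (psi * psi_ratio\<^sup>2) $ m else 0)
    + 280 * (if i = 0 then (fps_X * (psi * psi_ratio ^ 3)) $ m else 0) + 16 * k $ (4 * m + i)" if "i < 4" for i
    unfolding k fps_add_nth fps_numeral_mult_nth using that by (subst fps_X_power_mult_dil4_nth, simp, simp)+ simp
  show "2 dvd (theta * theta_param) $ (4 * m + 2)" "4 dvd (theta * theta_param) $ (4 * m + 3)"
    using nth[of 2] nth[of 3] by simp_all
  assume m: "odd m"
  show "16 dvd (theta * theta_param) $ (4 * m + 1)"
    using nth[of 1] psi_nth_odd[OF m] by simp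
  obtain e where "(psi * psi_ratio\<^sup>2) $ m = 4 * e" using psi_ratio_nth_odd[OF m] by blast
  then show "16 dvd (theta * theta_param) $ (4 * m + 3)"
    using nth[of 3] by simp
qed

lemma v0_quarter_nth:
  "16 dvd v0_quarter $ (4 * m + 2)"
  "32 dvd v0_quarter $ (4 * m + 3)"
  "odd m \<Longrightarrow> 128 dvd v0_quarter $ (4 * m + 1)"
  "odd m \<Longrightarrow> 128 dvd v0_quarter $ (4 * m + 3)"
proof -
  define b h S where "b = dil4 theta * half_beta" and "h = half_beta" and "S = dil4 theta_quot"
  have mono: "b * h ^ j * S = fps_X ^ Suc j * dil4 (psi * psi_ratio ^ j * theta_quot)" for j
    unfolding b_def h_def half_beta_monomial S_def by (simp only: dil4_mult mult_ac)
  have "v0_quarter = dil4 theta * S + 6 * (b * h ^ 0 * S) + 16 * (b * h ^ 1 * S)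
      + 32 * (b * h\<^sup>2 * S) + 48 * (b * h ^ 3 * S) + 32 * (b * h ^ 4 * S)"
    unfolding v0_quarter_half_beta b_def h_def S_def by algebra
  also have "\<dots> = fps_X ^ 0 * dil4 (theta * theta_quot) + 6 * (fps_X ^ 1 * dil4 (psi * theta_quot))
      + 16 * (fps_X ^ 2 * dil4 (psi * psi_ratio * theta_quot)) + 32 * (fps_X ^ 3 * dil4 (psi * psi_ratio\<^sup>2 * theta_quot))
      + 48 * (fps_X ^ 0 * dil4 (fps_X * (psi * psi_ratio ^ 3 * theta_quot)))
      + 32 * (fps_X ^ 1 * dil4 (psi * theta_param))"
  proof -
    have "b * h ^ 0 * S = fps_X ^ 1 * dil4 (psi * theta_quot)"
      unfolding mono by (simp only: One_nat_def power_0 mult_1_right)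
    moreover have "b * h ^ 1 * S = fps_X\<^sup>2 * dil4 (psi * psi_ratio * theta_quot)"
      unfolding mono by (simp only: Suc_1 power_one_right)
    moreover have "b * h\<^sup>2 * S = fps_X ^ 3 * dil4 (psi * psi_ratio\<^sup>2 * theta_quot)"
      unfolding mono by (simp only: Suc_numeral add_num_simps)
    moreover have "b * h ^ 3 * S = fps_X ^ 0 * dil4 (fps_X * (psi * psi_ratio ^ 3 * theta_quot))"
      unfolding mono dil4_mult dil4_X by (simp only: Suc_numeral add_num_simps power_0 mult_1_left)
    \<comment> \<open>The part of degree 5 returns to residue 1, and the q^4 it releases completes
      \<open>theta_param\<close>.\<close>
    moreover have "b * h ^ 4 * S = fps_X ^ 1 * dil4 (psi * theta_param)"
      unfolding mono theta_param_def dil4_mult dil4_X power_Suc power_one_right by (simp only: mult_ac)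
    moreover have "dil4 theta * S = fps_X ^ 0 * dil4 (theta * theta_quot)"
      by (simp only: S_def dil4_mult power_0 mult_1_left)
    ultimately show ?thesis by (simp only:)
  qed
  finally have eq: "v0_quarter = fps_X ^ 0 * dil4 (theta * theta_quot) + 6 * (fps_X ^ 1 * dil4 (psi * theta_quot))
      + 16 * (fps_X ^ 2 * dil4 (psi * psi_ratio * theta_quot)) + 32 * (fps_X ^ 3 * dil4 (psi * psi_ratio\<^sup>2 * theta_quot))
      + 48 * (fps_X ^ 0 * dil4 (fps_X * (psi * psi_ratio ^ 3 * theta_quot)))
      + 32 * (fps_X ^ 1 * dil4 (psi * theta_param))" .
  have nth: "v0_quarter $ (4 * m + i) = (if i = 0 then (theta * theta_quot) $ m else 0)
      + 6 * (if i = 1 then (psi * theta_quot) $ m else 0) + 16 * (if i = 2 then (psi * psi_ratio * theta_quot) $ m else 0)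
      + 32 * (if i = 3 then (psi * psi_ratio\<^sup>2 * theta_quot) $ m else 0)
      + 48 * (if i = 0 then (fps_X * (psi * psi_ratio ^ 3 * theta_quot)) $ m else 0)
      + 32 * (if i = 1 then (psi * theta_param) $ m else 0)" if "i < 4" for i
    unfolding eq fps_add_nth fps_numeral_mult_nth using that by (subst fps_X_power_mult_dil4_nth, simp, simp)+ simp
  show "16 dvd v0_quarter $ (4 * m + 2)" "32 dvd v0_quarter $ (4 * m + 3)"
    using nth[of 2] nth[of 3] by simp_all
  have quot_nth: "(f * theta_quot) $ m = f $ m + 16 * (f * theta_param) $ m" for f
  proof -
    have "f * theta_quot = f + 16 * (f * theta_param)" unfolding theta_quot_eq by (simp only: distrib_left mult_1_right mult_1_left mult_ac)
    then show ?thesis by (simp only: fps_add_nth fps_numeral_mult_nth)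
  qed
  assume m: "odd m"
  \<comment> \<open>At odd m the plain \<open>psi\<close> part vanishes; what is left is 6 * 16 + 32
    = 128 times a coefficient of \<open>psi * theta_param\<close>.\<close>
  show "128 dvd v0_quarter $ (4 * m + 1)"
    using nth[of 1] psi_nth_odd[OF m] by (simp add: quot_nth)
  obtain e where "(psi * psi_ratio\<^sup>2) $ m = 4 * e" using psi_ratio_nth_odd[OF m] by blast
  then show "128 dvd v0_quarter $ (4 * m + 3)"
    using nth[of 3] by (simp add: quot_nth)
qed

text \<open>For nonsquare n the \<open>theta\<close> part vanishes. After \<alpha> \<ge> 1 sections
  the rest is 4 * 8^(\<alpha>-1) * 16 = 2^(3\<alpha>+3) times
  \<open>theta * theta_param * r\<close>, where r is constant modulo 16, hence d \<le> 4. The bound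
  on \<open>v0_quarter\<close> settles \<alpha> = 0. One factor 2 is lost since
  \<open>v0_quarter\<close> carries twice \<open>v0\<close>.\<close>

lemma v0_quarter_dvd:
  assumes nonsquare: "\<nexists>k. n = k\<^sup>2"
    and "2 ^ (d + 3) dvd v0_quarter $ n" "2 ^ d dvd (theta * theta_param) $ n" "d \<le> 4"
  shows "2 ^ (3 * \<alpha> + 2 + d) dvd v0 (4 * 4 ^ \<alpha> * n)"
proof -
  \<comment> \<open>This avoids the correction -1 in the constant coefficient of
    \<open>v0_quarter\<close>.\<close>
  have "n \<noteq> 0" using nonsquare by (metis zero_power2)
  then have two: "2 * v0 (4 * 4 ^ \<alpha> * n) = (fps_section 4 ^^ \<alpha>) v0_quarter $ n"
    by (simp add: fps_section_iterate_nth v0_quarter_def mult.assoc)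
  have "2 ^ (3 * \<alpha> + 3 + d) dvd (fps_section 4 ^^ \<alpha>) v0_quarter $ n"
  proof (cases \<alpha>)
    case 0
    then show ?thesis using assms(2) by (simp add: add.commute)
  next
    case (Suc \<gamma>)
    obtain r where r: "r \<in> quot_ring"
      "(fps_section 4 ^^ Suc \<gamma>) v0_quarter = theta + 4 * (8 ^ \<gamma> * (theta * (theta_quot - 1) * r))"
      using fps_section_iterate_v0_quarter by blast
    obtain c g where g: "r = fps_const c + 16 * g" using quot_ring_mod_16[OF r(1)] by blast
    have "4 * (8 ^ \<gamma> * (theta * (theta_quot - 1) * r)) =
        fps_const (64 * 8 ^ \<gamma>) * (fps_const c * (theta * theta_param) + 16 * (theta * theta_param * g))"
    proof -
      define K where "K = (8 ^ \<gamma> :: int fps)"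
      have "fps_const (64 * 8 ^ \<gamma>) = 64 * K"
        by (simp add: K_def fps_const_mult[symmetric] fps_const_power[symmetric] numeral_fps_const del: fps_const_mult fps_const_power)
      then show ?thesis unfolding g theta_quot_minus_1 K_def[symmetric] by algebra
    qed
    then have "(fps_section 4 ^^ \<alpha>) v0_quarter $ n =
        64 * 8 ^ \<gamma> * (c * (theta * theta_param) $ n + 16 * (theta * theta_param * g) $ n)"
      unfolding Suc r(2)
      by (simp only: fps_add_nth fps_mult_left_const_nth fps_numeral_mult_nth theta_nth_nonsquare[OF nonsquare] add_0_left)
    moreover have "2 ^ d dvd c * (theta * theta_param) $ n + 16 * (theta * theta_param * g) $ n"
    proof (rule dvd_add)
      show "2 ^ d dvd c * (theta * theta_param) $ n" using assms(3) by simp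
      have "(2::int) ^ d dvd 2 ^ 4" using assms(4) by (rule le_imp_power_dvd)
      then show "2 ^ d dvd 16 * (theta * theta_param * g) $ n" by simp
    qed
    moreover have "2 ^ (3 * \<alpha> + 3 + d) = 64 * 8 ^ \<gamma> * (2 :: int) ^ d"
      by (simp add: Suc power_add power_mult)
    ultimately show ?thesis by (metis mult_dvd_mono dvd_refl)
  qed
  then have "2 * 2 ^ (3 * \<alpha> + 2 + d) dvd 2 * v0 (4 * 4 ^ \<alpha> * n)"
    unfolding two by (simp add: numeral_3_eq_3)
  then show ?thesis
    by (rule dvd_times_left_cancel_iff[THEN iffD1, rotated]) simp
qed

section \<open>The congruences for \<open>v0\<close>\<close>

lemma nonsquare_mod_8:
  assumes "n mod 8 \<notin> {0, 1, 4}"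
  shows "\<nexists>k. n = (k::nat)\<^sup>2"
  using square_mod_8 assms by blast

lemma v0_dvd:
  "2 ^ (3 * \<alpha> + 2 + 1) dvd v0 (4 * 4 ^ \<alpha> * (4 * m + 2))"
  "2 ^ (3 * \<alpha> + 2 + 2) dvd v0 (4 * 4 ^ \<alpha> * (4 * m + 3))"
  "odd m \<Longrightarrow> 2 ^ (3 * \<alpha> + 2 + 4) dvd v0 (4 * 4 ^ \<alpha> * (4 * m + 1))"
  "odd m \<Longrightarrow> 2 ^ (3 * \<alpha> + 2 + 4) dvd v0 (4 * 4 ^ \<alpha> * (4 * m + 3))"
proof -
  have 2: "(4 * m + 2) mod 8 \<notin> {0, 1, 4}" and 3: "(4 * m + 3) mod 8 \<notin> {0, 1, 4}"
    unfolding insert_iff empty_iff by presburger+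
  show "2 ^ (3 * \<alpha> + 2 + 1) dvd v0 (4 * 4 ^ \<alpha> * (4 * m + 2))"
    by (rule v0_quarter_dvd[OF nonsquare_mod_8[OF 2]])
      (use v0_quarter_nth(1)[of m] theta_param_nth(1)[of m] in simp_all)
  show "2 ^ (3 * \<alpha> + 2 + 2) dvd v0 (4 * 4 ^ \<alpha> * (4 * m + 3))"
    by (rule v0_quarter_dvd[OF nonsquare_mod_8[OF 3]])
      (use v0_quarter_nth(2)[of m] theta_param_nth(2)[of m] in simp_all)
  assume m: "odd m"
  then have 1: "(4 * m + 1) mod 8 \<notin> {0, 1, 4}"
    unfolding insert_iff empty_iff by presburger
  show "2 ^ (3 * \<alpha> + 2 + 4) dvd v0 (4 * 4 ^ \<alpha> * (4 * m + 1))"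
    by (rule v0_quarter_dvd[OF nonsquare_mod_8[OF 1]])
      (use v0_quarter_nth(3)[OF m] theta_param_nth(3)[OF m] in simp_all)
  show "2 ^ (3 * \<alpha> + 2 + 4) dvd v0 (4 * 4 ^ \<alpha> * (4 * m + 3))"
    by (rule v0_quarter_dvd[OF nonsquare_mod_8[OF 3]])
      (use v0_quarter_nth(4)[OF m] theta_param_nth(4)[OF m] in simp_all)
qed

theorem theorem1p2:
  fixes n \<alpha> :: nat
  shows "[v0 (2 ^ (2 * \<alpha> + 1) * (2 * n + 1)) = 0] (mod 2 ^ (3 * \<alpha>))
       \<and> [v0 (2 ^ (2 * \<alpha> + 2) * (4 * n + 3)) = 0] (mod 2 ^ (3 * \<alpha> + 4))
       \<and> [v0 (2 ^ (2 * \<alpha> + 2) * (8 * n + 7)) = 0] (mod 2 ^ (3 * \<alpha> + 6))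
       \<and> [v0 (2 ^ (2 * \<alpha> + 2) * (8 * n + 5)) = 0] (mod 2 ^ (3 * \<alpha> + 6))"
proof -
  have four: "(2 :: nat) ^ (2 * \<alpha> + 2) = 4 * 4 ^ \<alpha>" for \<alpha>
    by (simp add: power_add power_mult)
  have 1: "2 ^ (3 * \<alpha>) dvd v0 (2 ^ (2 * \<alpha> + 1) * (2 * n + 1))"
  proof (cases \<alpha>)
    \<comment> \<open>For \<alpha> = 0 the modulus is 1. Otherwise the odd power of 2 leaves a
      factor 2, and 2 (2n + 1) = 4n + 2 lies in residue class 2.\<close>
    case (Suc \<gamma>)
    have "(2 :: nat) ^ (2 * \<alpha> + 1) * (2 * n + 1) = 4 * 4 ^ \<gamma> * (4 * n + 2)"
      by (simp add: Suc power_add power_mult)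
    moreover have "3 * \<alpha> = 3 * \<gamma> + 2 + 1" by (simp add: Suc)
    ultimately show ?thesis using v0_dvd(1)[of \<gamma> n] by (simp only:)
  qed simp
  \<comment> \<open>Both progressions modulo 8 are the odd case m = 2n + 1 of the residues 3 and 1
    modulo 4.\<close>
  have 2: "8 * n + 7 = 4 * (2 * n + 1) + 3" "8 * n + 5 = 4 * (2 * n + 1) + 1"
    "3 * \<alpha> + 4 = 3 * \<alpha> + 2 + 2" "3 * \<alpha> + 6 = 3 * \<alpha> + 2 + 4" by simp_all
  have odd: "odd (2 * n + 1)" by simp
  show ?thesis
    unfolding cong_0_iff four 2 using 1 v0_dvd(2)[of \<alpha> n] v0_dvd(3,4)[OF odd, of \<alpha>] by blast
qed

end
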